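(* Let $\mathscr A$ be a $C^*$-algebra and let $\mathscr X$ be a (right) Hilbert $\mathscr A$-module. Let $f:[0,\infty)\to(0,\infty)$ be a function such that $f(t)\ge t+M$ for some $M>0$. Then $$\left|y\,(f(c)-c)^{-1/2}-x\,(f(c)-c)^{1/2}\right|^2+c\,|x|^2\ \ge\ c\,f(c)^{-1}(f(c)-c)^{-1}\,|y|^2$$ for all positive central elements $c\in\mathscr A$ and all elements $x,y\in\mathscr X$. The equality holds if and only if $y=x\,f(c)$.
   Context: A Hilbert $C^*$-module over $\mathscr A$ is a right $\mathscr A$-module with an $\mathscr A$-valued inner product $\langle\cdot,\cdot\rangle$ that is linear in the second variable, satisfies $\langle x,x\rangle\ge 0$ with equality only for $x=0$, $\langle x,ya\rangle=\langle x,y\rangle a$ and $\langle x,y\rangle^*=\langle y,x\rangle$, and is complete in the norm $\|x\|=\|\langle x,x\rangle\|^{1/2}$. For $x\in\mathscr X$, $|x|=\langle x,x\rangle^{1/2}\in\mathscr A$, so $|x|^2=\langle x,x\rangle$. The elements $f(c)$, $f(c)-c$ and their powers are understood through the functional calculus. The order $\ge$ is the usual order on self-adjoint elements of a $C^*$-algebra. *)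

theory Defs
  imports "HOL-Analysis.Analysis" "HOL-Computational_Algebra.Polynomial"
begin

class complex_vector = ab_group_add +
  fixes scaleC :: "complex \<Rightarrow> 'a \<Rightarrow> 'a"
  assumes scaleC_add_right: "scaleC z (x + y) = scaleC z x + scaleC z y"
    and scaleC_add_left: "scaleC (z + w) x = scaleC z x + scaleC w x"
    and scaleC_scaleC: "scaleC z (scaleC w x) = scaleC (z * w) x"
    and scaleC_one: "scaleC 1 x = x"

text \<open>C*-algebras, not necessarily unital (and possibly zero).\<close>

class cstar_algebra = complex_vector + real_normed_algebra + complete_space +
  fixes star :: "'a \<Rightarrow> 'a"
  assumes scaleR_scaleC: "scaleR r x = scaleC (complex_of_real r) x"
    and norm_scaleC: "norm (scaleC z x) = cmod z * norm x"
    and mult_scaleC_left: "scaleC z x * y = scaleC z (x * y)"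
    and mult_scaleC_right: "x * scaleC z y = scaleC z (x * y)"
    and star_star: "star (star x) = x"
    and star_add: "star (x + y) = star x + star y"
    and star_scaleC: "star (scaleC z x) = scaleC (cnj z) (star x)"
    and star_mult: "star (x * y) = star y * star x"
    and cstar_identity: "norm (star x * x) = (norm x)\<^sup>2"

definition central :: "'a::cstar_algebra \<Rightarrow> bool" where
  "central c \<longleftrightarrow> (\<forall>a. c * a = a * c)"

text \<open>
  If the algebra \<open>A\<close> has no unit, then \<open>f c\<close> with \<open>f 0 \<noteq> 0\<close> lives in the unitization
  \<open>A \<oplus> \<complex>\<close>, so spectra and the functional calculus are taken there.  This is done uniformly,
  also if \<open>A\<close> already has a unit \<open>e\<close>.  In that case \<open>(a, z) \<mapsto> (a + z e, z)\<close> is an isomorphism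
  from \<open>A \<oplus> \<complex>\<close> onto the product algebra \<open>A \<times> \<complex>\<close>; it maps \<open>f (c, 0)\<close> to \<open>(f c, f 0)\<close>, and
  therefore \<open>f (c, 0)\<close> acts on \<open>A\<close> and on Hilbert \<open>A\<close>-modules as the element \<open>f c\<close> of \<open>A\<close> does.
\<close>

datatype 'a unitization = Unitization (alg_part: 'a) (scalar_part: complex)

instantiation unitization :: (cstar_algebra) ring_1
begin

definition "0 = Unitization 0 0"
definition "1 = Unitization 0 1"
definition "u + v = Unitization (alg_part u + alg_part v) (scalar_part u + scalar_part v)"
definition "u - v = Unitization (alg_part u - alg_part v) (scalar_part u - scalar_part v)"
definition "- u = Unitization (- alg_part u) (- scalar_part u)"
definition "u * v = Unitization
  (alg_part u * alg_part v + scaleC (scalar_part u) (alg_part v) + scaleC (scalar_part v) (alg_part u))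
  (scalar_part u * scalar_part v)"

instance
proof
  fix u v w :: "'a unitization"
  have scaleC_zero: "scaleC z (0::'a) = 0" for z
    using scaleC_add_right[of z "0::'a" 0] by simp
  have zero_scaleC: "scaleC 0 (a::'a) = 0" for a
    using scaleC_add_left[of 0 0 a] by simp
  note defs = zero_unitization_def one_unitization_def plus_unitization_def
    minus_unitization_def uminus_unitization_def times_unitization_def
  show "u * v * w = u * (v * w)"
    by (simp add: defs algebra_simps scaleC_add_right scaleC_scaleC
        mult_scaleC_left mult_scaleC_right)
  show "(u + v) * w = u * w + v * w" "u * (v + w) = u * v + u * w"
    by (simp_all add: defs algebra_simps scaleC_add_right scaleC_add_left)
  show "1 * u = u" "u * 1 = u"
    by (simp_all add: defs scaleC_one scaleC_zero)
qed (simp_all add: zero_unitization_def one_unitization_def plus_unitization_def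
    minus_unitization_def uminus_unitization_def algebra_simps)

end

definition emb :: "'a::cstar_algebra \<Rightarrow> 'a unitization" where
  "emb a = Unitization a 0"

definition scalar :: "complex \<Rightarrow> 'a::cstar_algebra unitization" where
  "scalar z = Unitization 0 z"

definition ustar :: "'a::cstar_algebra unitization \<Rightarrow> 'a unitization" where
  "ustar u = Unitization (star (alg_part u)) (cnj (scalar_part u))"

definition spectrum :: "'a::cstar_algebra unitization \<Rightarrow> complex set" where
  "spectrum u = {z. \<not> (\<exists>v. (u - scalar z) * v = 1 \<and> v * (u - scalar z) = 1)}"

definition real_spectrum :: "'a::cstar_algebra unitization \<Rightarrow> real set" where
  "real_spectrum u = {t. complex_of_real t \<in> spectrum u}"

definition positive_elem :: "'a::cstar_algebra unitization \<Rightarrow> bool" where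
  "positive_elem u \<longleftrightarrow> ustar u = u \<and> spectrum u \<subseteq> complex_of_real ` {0..}"

text \<open>The order of \<open>A\<close> is the restriction of this order along \<^const>\<open>emb\<close>.\<close>

definition cstar_le :: "'a::cstar_algebra unitization \<Rightarrow> 'a unitization \<Rightarrow> bool" where
  "cstar_le u v \<longleftrightarrow> ustar u = u \<and> ustar v = v \<and> positive_elem (v - u)"

definition poly_eval :: "real poly \<Rightarrow> 'a::cstar_algebra unitization \<Rightarrow> 'a unitization" where
  "poly_eval p u = (\<Sum>i\<le>degree p. scalar (complex_of_real (coeff p i)) * u ^ i)"

text \<open>
  Continuous functional calculus for real-valued functions at a self-adjoint element \<open>u\<close>, whose
  spectrum is real: \<open>f u\<close> is the limit of \<open>p\<^sub>n u\<close> for any polynomials \<open>p\<^sub>n\<close> converging to \<open>f\<close>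
  uniformly on the spectrum.  Convergence in the C*-norm of the unitization is convergence of both
  components, since that norm is equivalent to \<open>norm a + cmod z\<close>.  The value is meaningful
  exactly when \<open>u\<close> is self-adjoint and \<open>f\<close> is continuous on the spectrum of \<open>u\<close>.
\<close>

definition cfc :: "(real \<Rightarrow> real) \<Rightarrow> 'a::cstar_algebra unitization \<Rightarrow> 'a unitization" where
  "cfc f u = (THE v. \<exists>p :: nat \<Rightarrow> real poly.
     uniform_limit (real_spectrum u) (\<lambda>n. poly (p n)) f sequentially \<and>
     (\<lambda>n. alg_part (poly_eval (p n) u)) \<longlonglongrightarrow> alg_part v \<and>
     (\<lambda>n. scalar_part (poly_eval (p n) u)) \<longlonglongrightarrow> scalar_part v)"

definition cpow :: "'a::cstar_algebra unitization \<Rightarrow> real \<Rightarrow> 'a unitization" where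
  "cpow u s = cfc (\<lambda>t. t powr s) u"

locale hilbert_module =
  fixes act :: "'x::complex_vector \<Rightarrow> 'a::cstar_algebra \<Rightarrow> 'x"
    and ip :: "'x \<Rightarrow> 'x \<Rightarrow> 'a"
  assumes act_add_left: "act (x + y) a = act x a + act y a"
    and act_add_right: "act x (a + b) = act x a + act x b"
    and act_mult: "act x (a * b) = act (act x a) b"
    and act_scaleC_left: "act (scaleC z x) a = scaleC z (act x a)"
    and act_scaleC_right: "act x (scaleC z a) = scaleC z (act x a)"
    and ip_add_right: "ip x (y + y') = ip x y + ip x y'"
    and ip_scaleC_right: "ip x (scaleC z y) = scaleC z (ip x y)"
    and ip_act_right: "ip x (act y a) = ip x y * a"
    and star_ip: "star (ip x y) = ip y x"
    and ip_positive: "positive_elem (emb (ip x x))"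
    and ip_definite: "ip x x = 0 \<Longrightarrow> x = 0"
    and complete:
      "(\<forall>e>0. \<exists>N. \<forall>m\<ge>N. \<forall>n\<ge>N. sqrt (norm (ip (s m - s n) (s m - s n))) < e) \<Longrightarrow>
       \<exists>l. (\<lambda>n. sqrt (norm (ip (s n - l) (s n - l)))) \<longlonglongrightarrow> 0"

text \<open>The canonical extension of a module action to the unitization.\<close>

definition uact ::
  "('x::complex_vector \<Rightarrow> 'a::cstar_algebra \<Rightarrow> 'x) \<Rightarrow> 'x \<Rightarrow> 'a unitization \<Rightarrow> 'x" where
  "uact act x u = act x (alg_part u) + scaleC (scalar_part u) x"

text \<open>The scalar part of \<open>modulus ip x\<close> is \<open>0\<close>, because \<open>0 powr (1/2) = 0\<close>; so it lies in \<open>A\<close>.\<close>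

definition modulus :: "('x \<Rightarrow> 'x \<Rightarrow> 'a::cstar_algebra) \<Rightarrow> 'x \<Rightarrow> 'a unitization" where
  "modulus ip x = cpow (emb (ip x x)) (1/2)"

end

theory Submission
  imports Defs "HOL-Computational_Algebra.Fundamental_Theorem_Algebra"
begin

text \<open>Put \<open>F = f c\<close>, which is self-adjoint, central and invertible, as is \<open>F - c\<close>.  Expanding the
  first square, the difference of the two sides is
  \<open>F |x|\<^sup>2 - \<langle>x, y\<rangle> - \<langle>y, x\<rangle> + F\<^sup>-\<^sup>1 |y|\<^sup>2 = |y F\<^sup>-\<^sup>1\<^sup>/\<^sup>2 - x F\<^sup>1\<^sup>/\<^sup>2|\<^sup>2\<close>,
  because \<open>(F - c)\<^sup>-\<^sup>1 - c F\<^sup>-\<^sup>1 (F - c)\<^sup>-\<^sup>1 = F\<^sup>-\<^sup>1\<close>.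
  It vanishes exactly if \<open>y F\<^sup>-\<^sup>1\<^sup>/\<^sup>2 = x F\<^sup>1\<^sup>/\<^sup>2\<close>, that is, \<open>y = x F\<close>.
  The functional calculus rests on the fact that a self-adjoint element has a spectral value of
  modulus equal to its norm.\<close>

section \<open>Invertible elements and the C*-norm of the unitization\<close>

text \<open>The positivity of the difference is the module axiom \<open>ip_positive\<close> at a
  single vector, so the closing algebra is short; the bulk is the calculus that supplies the powers
  of \<open>f c\<close> and \<open>f c - c\<close>. It lives in the unitization, because the scalar
  part of \<open>f c\<close> is \<open>f 0 > 0\<close>, and it calls for a complete C*-norm there
  that agrees with the componentwise convergence in \<open>cfc\<close>. The central estimate is
  that, for a real polynomial \<open>p\<close> and self-adjoint \<open>u\<close>, any bound for the
  absolute value of \<open>p\<close> on the spectrum also bounds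
  \<open>norm (poly_eval p u)\<close>; existence and uniqueness of \<open>cfc\<close> both follow
  from it. The spectral value of modulus \<open>norm u\<close> behind this estimate comes from
  averaging inverses over roots of unity, with compactness of a closed disc making the averages
  equicontinuous. Centrality and self-adjointness pass from \<open>c\<close> to everything else
  through polynomial limits.\<close>

definition mutually_inverse :: "'a::monoid_mult \<Rightarrow> 'a \<Rightarrow> bool" where
  "mutually_inverse x y \<longleftrightarrow> x * y = 1 \<and> y * x = 1"

lemma mutually_inverse_mult:
  assumes "mutually_inverse x y" "mutually_inverse x' y'"
  shows "mutually_inverse (x * x') (y' * y)"
  using assms unfolding mutually_inverse_def by (metis mult.assoc mult_1_right)

lemma mutually_inverse_one_minus:
  fixes x :: "'a::{real_normed_algebra_1,banach}"
  assumes "norm x < 1"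
  shows "mutually_inverse (1 - x) (\<Sum>n. x ^ n)"
proof -
  have s: "summable (\<lambda>n. x ^ n)"
    by (rule complete_algebra_summable_geometric[OF assms])
  have e: "(\<Sum>n. x ^ n) = 1 + (\<Sum>n. x ^ Suc n)"
    using suminf_split_head[OF s] by simp
  have "(\<Sum>n. x ^ Suc n) = x * (\<Sum>n. x ^ n)"
    using suminf_mult[OF s, of x] by simp
  moreover have "(\<Sum>n. x ^ Suc n) = (\<Sum>n. x ^ n) * x"
    using suminf_mult2[OF s, of x] by (simp add: power_commutes)
  ultimately show ?thesis
    using e by (simp add: mutually_inverse_def algebra_simps)
qed

text \<open>The resolvent identity \<open>y' - y = y' * (x - x') * y\<close> leaves
  \<open>y'\<close> in the bound; the smallness hypothesis gives
  \<open>norm y' \<le> 2 * norm y\<close>, which removes it.\<close>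

lemma norm_inverse_diff_le:
  fixes x :: "'a::real_normed_algebra_1"
  assumes "mutually_inverse x y" "mutually_inverse x' y'" and "norm y * norm (x' - x) \<le> 1/2"
  shows "norm (y' - y) \<le> 2 * (norm y)\<^sup>2 * norm (x' - x)"
proof -
  have eq: "y' - y = y' * (x - x') * y"
    using assms(1,2) unfolding mutually_inverse_def
    by (simp add: algebra_simps)
  have "norm (y' - y) \<le> norm (y' * (x - x')) * norm y"
    unfolding eq by (rule norm_mult_ineq)
  also have "\<dots> \<le> (norm y' * norm (x - x')) * norm y"
    by (intro mult_right_mono norm_mult_ineq norm_ge_zero)
  finally have d: "norm (y' - y) \<le> norm y' * (norm y * norm (x' - x))"
    by (simp add: norm_minus_commute mult_ac)
  also have "\<dots> \<le> norm y' * (1/2)"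
    by (intro mult_left_mono assms norm_ge_zero)
  finally have "norm y' \<le> 2 * norm y"
    using norm_triangle_ineq2[of y' y] by simp
  then have "norm y' * (norm y * norm (x' - x)) \<le> 2 * norm y * (norm y * norm (x' - x))"
    by (intro mult_right_mono) auto
  with d show ?thesis by (simp add: power2_eq_square mult_ac)
qed

text \<open>Here \<open>h\<close> is an arbitrary pointwise choice of inverses. The preceding bound,
  with the fixed inverse \<open>h w\<close> as \<open>y\<close>, makes every such choice
  continuous.\<close>

lemma continuous_on_inverse_elem:
  fixes g h :: "'b::metric_space \<Rightarrow> 'a::real_normed_algebra_1"
  assumes "continuous_on S g" and "\<And>w. w \<in> S \<Longrightarrow> mutually_inverse (g w) (h w)"
  shows "continuous_on S h"
  unfolding continuous_on_def
proof
  fix w assume w: "w \<in> S"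
  have g: "((\<lambda>v. norm (g v - g w)) \<longlongrightarrow> 0) (at w within S)"
    using assms(1) w unfolding continuous_on_def
    by (intro tendsto_norm_zero) (simp add: LIM_zero)
  have "((\<lambda>v. norm (h w) * norm (g v - g w)) \<longlongrightarrow> norm (h w) * 0) (at w within S)"
    by (intro tendsto_intros g)
  then have "\<forall>\<^sub>F v in at w within S. norm (h w) * norm (g v - g w) < 1/2"
    by (rule order_tendstoD) simp
  moreover have "\<forall>\<^sub>F v in at w within S. v \<in> S"
    by (simp add: eventually_at_filter)
  ultimately have "\<forall>\<^sub>F v in at w within S.
      norm (h v - h w) \<le> 2 * (norm (h w))\<^sup>2 * norm (g v - g w)"
    by eventually_elim (use assms(2) w in \<open>auto intro!: norm_inverse_diff_le\<close>)
  moreover have "((\<lambda>v. 2 * (norm (h w))\<^sup>2 * norm (g v - g w)) \<longlongrightarrow> 0) (at w within S)"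
    using tendsto_mult_right_zero[OF g] .
  ultimately have "((\<lambda>v. h v - h w) \<longlongrightarrow> 0) (at w within S)"
    by (rule Lim_null_comparison)
  then show "(h \<longlongrightarrow> h w) (at w within S)"
    by (simp add: LIM_zero_iff)
qed

section \<open>Algebra and involution in \<open>A\<close> and in its unitization\<close>

lemma scaleC_zero_right [simp]: "scaleC z 0 = 0"
  using scaleC_add_right[of z 0 0] by simp

lemma scaleC_zero_left [simp]: "scaleC 0 x = 0"
  using scaleC_add_left[of 0 0 x] by simp

lemma star_zero [simp]: "star 0 = 0"
  using star_add[of 0 0] by simp

lemma star_minus: "star (- x) = - star x"
  using star_add[of x "- x"] by (simp add: eq_neg_iff_add_eq_0 add.commute)

lemma star_diff: "star (x - y) = star x - star y"
  using star_add[of x "- y"] by (simp add: star_minus)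

lemma norm_star: "norm (star x) = norm x"
proof -
  have "norm x \<le> norm (star x)" for x :: 'a
  proof (cases "norm x = 0")
    case False
    have "norm x * norm x \<le> norm (star x) * norm x"
      using norm_mult_ineq[of "star x" x] by (simp add: cstar_identity power2_eq_square)
    with False show ?thesis by (auto simp: mult_le_cancel_right)
  qed simp
  from this[of x] this[of "star x"] show ?thesis by (simp add: star_star)
qed

lemma alg_part_simps [simp]:
  "alg_part (0 :: 'a::cstar_algebra unitization) = 0"
  "alg_part (1 :: 'a unitization) = 0"
  "alg_part (u + v) = alg_part u + alg_part v"
  "alg_part (u - v) = alg_part u - alg_part v"
  "alg_part (- u) = - alg_part u"
  "alg_part (u * v) =
     alg_part u * alg_part v + scaleC (scalar_part u) (alg_part v) + scaleC (scalar_part v) (alg_part u)"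
  "alg_part (emb a) = a"
  "alg_part (scalar z :: 'a unitization) = 0"
  "alg_part (ustar u) = star (alg_part u)"
  for u v :: "'a::cstar_algebra unitization"
  by (simp_all add: zero_unitization_def one_unitization_def plus_unitization_def
      minus_unitization_def uminus_unitization_def times_unitization_def emb_def scalar_def ustar_def)

lemma scalar_part_simps [simp]:
  "scalar_part (0 :: 'a::cstar_algebra unitization) = 0"
  "scalar_part (1 :: 'a unitization) = 1"
  "scalar_part (u + v) = scalar_part u + scalar_part v"
  "scalar_part (u - v) = scalar_part u - scalar_part v"
  "scalar_part (- u) = - scalar_part u"
  "scalar_part (u * v) = scalar_part u * scalar_part v"
  "scalar_part (emb a) = 0"
  "scalar_part (scalar z :: 'a unitization) = z"
  "scalar_part (ustar u) = cnj (scalar_part u)"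
  for u v :: "'a::cstar_algebra unitization"
  by (simp_all add: zero_unitization_def one_unitization_def plus_unitization_def
      minus_unitization_def uminus_unitization_def times_unitization_def emb_def scalar_def ustar_def)

lemma scalar_zero [simp]: "scalar 0 = 0"
  and scalar_one [simp]: "scalar 1 = 1"
  and scalar_add: "scalar (z + w) = scalar z + scalar w"
  and scalar_diff: "scalar (z - w) = scalar z - scalar w"
  and scalar_minus: "scalar (- z) = - scalar z"
  and scalar_mult: "scalar (z * w) = scalar z * scalar w"
  and ustar_scalar: "ustar (scalar z) = scalar (cnj z)"
  by (auto intro: unitization.expand)

lemma scalar_commute: "scalar z * u = u * scalar z"
  by (auto intro: unitization.expand)

lemma emb_diff: "emb (a - b) = emb a - emb b"
  and ustar_emb: "ustar (emb a) = emb (star a)"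
  by (auto intro: unitization.expand)

lemma ustar_zero [simp]: "ustar 0 = 0"
  and ustar_one [simp]: "ustar 1 = 1"
  and ustar_ustar [simp]: "ustar (ustar u) = u"
  and ustar_add: "ustar (u + v) = ustar u + ustar v"
  and ustar_diff: "ustar (u - v) = ustar u - ustar v"
  and ustar_mult: "ustar (u * v) = ustar v * ustar u"
  by (auto intro!: unitization.expand
      simp: star_star star_add star_diff star_minus star_mult star_scaleC)

lemma ustar_power: "ustar (u ^ n) = ustar u ^ n"
  by (induction n) (simp_all add: ustar_mult power_commutes)

lemma ustar_sum: "ustar (sum g A) = (\<Sum>i\<in>A. ustar (g i))"
  by (induction A rule: infinite_finite_induct) (simp_all add: ustar_add)

text \<open>\<open>A\<close> is an ideal of its unitization, so \<open>u * emb b\<close> stays in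
  \<open>A\<close>. This is the resulting representation of the unitization on \<open>A\<close>,
  from whose operator norm the C*-norm is built.\<close>

definition left_mult :: "'a::cstar_algebra unitization \<Rightarrow> 'a \<Rightarrow> 'a" where
  "left_mult u b = alg_part u * b + scaleC (scalar_part u) b"

lemma norm_left_mult_le: "norm (left_mult u b) \<le> (norm (alg_part u) + cmod (scalar_part u)) * norm b"
proof -
  have "norm (left_mult u b) \<le> norm (alg_part u * b) + norm (scaleC (scalar_part u) b)"
    unfolding left_mult_def by (rule norm_triangle_ineq)
  also have "\<dots> \<le> norm (alg_part u) * norm b + cmod (scalar_part u) * norm b"
    by (intro add_mono norm_mult_ineq) (simp add: norm_scaleC)
  finally show ?thesis by (simp add: algebra_simps)
qed

lemma left_mult_add: "left_mult (u + v) b = left_mult u b + left_mult v b"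
  by (simp add: left_mult_def algebra_simps scaleC_add_left)

lemma left_mult_mult: "left_mult (u * v) b = left_mult u (left_mult v b)"
  by (simp add: left_mult_def algebra_simps scaleC_add_right scaleC_scaleC
      mult_scaleC_left mult_scaleC_right)

lemma bounded_linear_left_mult: "bounded_linear (left_mult u)"
proof (rule bounded_linear_intro)
  show "norm (left_mult u b) \<le> norm b * (norm (alg_part u) + cmod (scalar_part u))" for b
    using norm_left_mult_le[of u b] by (simp add: mult.commute)
qed (simp_all add: left_mult_def algebra_simps scaleC_add_right scaleR_scaleC scaleC_scaleC
    mult_scaleC_right)

text \<open>With \<open>star a * b\<close> as an \<open>A\<close>-valued inner product on
  \<open>A\<close>, the operator of \<open>ustar u\<close> is the adjoint of that of
  \<open>u\<close>.\<close>

lemma star_mult_left_mult: "star a * left_mult u b = star (left_mult (ustar u) a) * b"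
  by (simp add: left_mult_def star_add star_mult star_star star_scaleC algebra_simps
      mult_scaleC_left mult_scaleC_right)

abbreviation left_norm :: "'a::cstar_algebra unitization \<Rightarrow> real" where
  "left_norm u \<equiv> onorm (left_mult u)"

lemma left_norm_le: "left_norm u \<le> norm (alg_part u) + cmod (scalar_part u)"
  by (rule onorm_bound) (simp_all add: norm_left_mult_le)

text \<open>Testing the operator on \<open>star a\<close>, where \<open>a\<close> is the algebra
  part, produces \<open>a * star a\<close>, of norm \<open>(norm a)\<^sup>2\<close>. Together with
  the scalar part, the operator norm thus controls both components.\<close>

lemma norm_alg_part_le: "norm (alg_part u) \<le> left_norm u + cmod (scalar_part u)"
proof -
  let ?a = "alg_part u"
  have "(norm ?a)\<^sup>2 = norm (?a * star ?a)"
    using cstar_identity[of "star ?a"] by (simp add: star_star norm_star)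
  also have "?a * star ?a = left_mult u (star ?a) - scaleC (scalar_part u) (star ?a)"
    by (simp add: left_mult_def)
  also have "norm \<dots> \<le> norm (left_mult u (star ?a)) + norm (scaleC (scalar_part u) (star ?a))"
    by (rule norm_triangle_ineq4)
  also have "\<dots> \<le> left_norm u * norm (star ?a) + cmod (scalar_part u) * norm (star ?a)"
    by (intro add_mono onorm bounded_linear_left_mult) (simp add: norm_scaleC)
  finally have "norm ?a * norm ?a \<le> (left_norm u + cmod (scalar_part u)) * norm ?a"
    by (simp add: norm_star algebra_simps power2_eq_square)
  moreover have "0 \<le> left_norm u"
    by (intro onorm_pos_le bounded_linear_left_mult)
  ultimately show ?thesis
    by (cases "norm ?a = 0") (simp_all add: mult_le_cancel_right)
qed

text \<open>The C*-identity of \<open>A\<close> and the adjoint relation turn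
  \<open>(norm (left_mult u b))\<^sup>2\<close> into the norm of
  \<open>star b * left_mult (ustar u * u) b\<close>.\<close>

lemma left_norm_ustar_mult: "(left_norm u)\<^sup>2 \<le> left_norm (ustar u * u)"
proof -
  let ?L = "left_norm (ustar u * u)"
  have L: "0 \<le> ?L"
    by (intro onorm_pos_le bounded_linear_left_mult)
  have "norm (left_mult u b) \<le> sqrt ?L * norm b" for b
  proof -
    have "(norm (left_mult u b))\<^sup>2 = norm (star (left_mult u b) * left_mult u b)"
      by (simp add: cstar_identity)
    also have "\<dots> = norm (star b * left_mult (ustar u * u) b)"
      by (simp add: left_mult_mult star_mult_left_mult)
    also have "\<dots> \<le> norm (star b) * norm (left_mult (ustar u * u) b)"
      by (rule norm_mult_ineq)
    also have "\<dots> \<le> norm b * (?L * norm b)"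
      by (simp add: norm_star mult_left_mono onorm bounded_linear_left_mult)
    also have "\<dots> = (sqrt ?L * norm b)\<^sup>2"
      using L by (simp add: power_mult_distrib power2_eq_square)
    finally show ?thesis
      by (rule power2_le_imp_le) (simp add: L)
  qed
  then have "left_norm u \<le> sqrt ?L"
    by (intro onorm_bound) (simp_all add: L)
  then have "(left_norm u)\<^sup>2 \<le> (sqrt ?L)\<^sup>2"
    by (intro power_mono onorm_pos_le bounded_linear_left_mult)
  with L show ?thesis by simp
qed

text \<open>The operator norm of left multiplication alone vanishes on \<open>(- e, 1)\<close> if \<open>A\<close> has a unit \<open>e\<close>.
  The maximum below is a C*-norm in all cases.\<close>

instantiation unitization :: (cstar_algebra) real_vector
begin

definition "scaleR r u = Unitization (scaleR r (alg_part u)) (scaleR r (scalar_part u))"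
instance
  by standard (auto intro!: unitization.expand simp: scaleR_unitization_def algebra_simps)

end

instantiation unitization :: (cstar_algebra) real_normed_algebra_1
begin

definition "norm (u::'a unitization) = max (left_norm u) (cmod (scalar_part u))"
definition "dist (u::'a unitization) v = norm (u - v)"
definition "sgn (u::'a unitization) = u /\<^sub>R norm u"
definition [code del]:
  "uniformity = (INF e\<in>{0 <..}. principal {(u::'a unitization, v). dist u v < e})"
definition [code del]:
  "open (S::'a unitization set) \<longleftrightarrow> (\<forall>u\<in>S. \<forall>\<^sub>F (u', v) in uniformity. u' = u \<longrightarrow> v \<in> S)"

lemma norm_unitization_le: "norm (u::'a unitization) \<le> norm (alg_part u) + cmod (scalar_part u)"
  using left_norm_le[of u] by (simp add: norm_unitization_def)

lemma norm_scalar_part_le: "cmod (scalar_part (u::'a unitization)) \<le> norm u"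
  by (simp add: norm_unitization_def)

lemma norm_alg_part_le_norm: "norm (alg_part (u::'a unitization)) \<le> 2 * norm u"
  using norm_alg_part_le[of u] by (simp add: norm_unitization_def)

instance
proof
  fix u v :: "'a unitization" and r :: real
  have pos: "0 \<le> left_norm w" for w :: "'a unitization"
    by (intro onorm_pos_le bounded_linear_left_mult)
  note defs = scaleR_unitization_def
  show "dist u v = norm (u - v)" by (rule dist_unitization_def)
  show "sgn u = u /\<^sub>R norm u" by (rule sgn_unitization_def)
  show "uniformity = (INF e\<in>{0 <..}. principal {(u::'a unitization, v). dist u v < e})"
    by (rule uniformity_unitization_def)
  show "open S \<longleftrightarrow> (\<forall>u\<in>S. \<forall>\<^sub>F (u', v) in uniformity. u' = u \<longrightarrow> v \<in> S)"
    for S :: "'a unitization set"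
    by (rule open_unitization_def)
  show "r *\<^sub>R u * v = r *\<^sub>R (u * v)" "u * r *\<^sub>R v = r *\<^sub>R (u * v)"
    by (auto intro!: unitization.expand
        simp: defs scaleR_scaleC mult_scaleC_left mult_scaleC_right scaleC_scaleC scaleC_add_right
          scaleR_conv_of_real mult_ac)
  show "norm u = 0 \<longleftrightarrow> u = 0"
  proof
    assume "norm u = 0"
    then have "norm (alg_part u) \<le> 0" "cmod (scalar_part u) \<le> 0"
      using norm_alg_part_le_norm[of u] norm_scalar_part_le[of u] by simp_all
    then show "u = 0" by (auto intro: unitization.expand)
  next
    assume "u = 0"
    then have "left_norm u \<le> 0" using left_norm_le[of u] by simp
    with \<open>u = 0\<close> show "norm u = 0" by (simp add: norm_unitization_def max_def pos antisym)
  qed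
  show "norm (u + v) \<le> norm u + norm v"
  proof -
    have "left_norm (u + v) \<le> left_norm u + left_norm v"
      using onorm_triangle[OF bounded_linear_left_mult bounded_linear_left_mult, of u v]
      by (simp add: left_mult_add[abs_def] fun_eq_iff)
    moreover have "cmod (scalar_part u + scalar_part v) \<le> cmod (scalar_part u) + cmod (scalar_part v)"
      by (rule norm_triangle_ineq)
    ultimately show ?thesis by (auto simp: norm_unitization_def)
  qed
  show "norm (r *\<^sub>R u) = \<bar>r\<bar> * norm u"
  proof -
    have "left_mult (r *\<^sub>R u) = (\<lambda>b. r *\<^sub>R left_mult u b)"
      by (simp add: fun_eq_iff left_mult_def defs scaleR_add_right)
        (simp add: scaleR_scaleC scaleC_scaleC scaleR_conv_of_real)
    then have "left_norm (r *\<^sub>R u) = \<bar>r\<bar> * left_norm u"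
      by (simp add: onorm_scaleR bounded_linear_left_mult)
    then show ?thesis
      by (simp add: norm_unitization_def defs max_mult_distrib_left)
  qed
  show "norm (u * v) \<le> norm u * norm v"
  proof -
    have "left_norm (u * v) \<le> left_norm u * left_norm v"
      using onorm_compose[OF bounded_linear_left_mult bounded_linear_left_mult, of u v]
      by (simp add: left_mult_mult[abs_def] comp_def)
    also have "\<dots> \<le> norm u * norm v"
      by (intro mult_mono) (auto simp: norm_unitization_def pos le_max_iff_disj)
    finally have "left_norm (u * v) \<le> norm u * norm v" .
    moreover have "cmod (scalar_part (u * v)) \<le> norm u * norm v"
      by (simp add: norm_mult)
        (intro mult_mono norm_scalar_part_le; simp add: norm_unitization_def pos le_max_iff_disj)
    ultimately show ?thesis by (simp add: norm_unitization_def[of "u * v"])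
  qed
  show "norm (1::'a unitization) = 1"
    using left_norm_le[of "1::'a unitization"] by (simp add: norm_unitization_def)
qed

end

instance unitization :: (cstar_algebra) banach
proof
  fix X :: "nat \<Rightarrow> 'a unitization"
  assume X: "Cauchy X"
  have "Cauchy (\<lambda>n. alg_part (X n))"
  proof (rule metric_CauchyI)
    fix e :: real assume "e > 0"
    then obtain M where M: "\<forall>m\<ge>M. \<forall>n\<ge>M. dist (X m) (X n) < e / 2"
      using X unfolding Cauchy_def by (meson half_gt_zero)
    have "norm (alg_part (X m) - alg_part (X n)) < e" if "m \<ge> M" "n \<ge> M" for m n
    proof -
      have "norm (X m - X n) < e / 2"
        using M[rule_format, OF that] by (simp add: dist_unitization_def)
      then show ?thesis using norm_alg_part_le_norm[of "X m - X n"] by simp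
    qed
    then show "\<exists>M. \<forall>m\<ge>M. \<forall>n\<ge>M. dist (alg_part (X m)) (alg_part (X n)) < e"
      by (auto simp: dist_norm)
  qed
  from convergentD[OF Cauchy_convergent[OF this]]
  obtain a where a: "(\<lambda>n. alg_part (X n)) \<longlonglongrightarrow> a" ..
  have "Cauchy (\<lambda>n. scalar_part (X n))"
  proof (rule metric_CauchyI)
    fix e :: real assume "e > 0"
    then obtain M where M: "\<forall>m\<ge>M. \<forall>n\<ge>M. dist (X m) (X n) < e"
      using X unfolding Cauchy_def by meson
    have "cmod (scalar_part (X m) - scalar_part (X n)) < e" if "m \<ge> M" "n \<ge> M" for m n
    proof -
      have "norm (X m - X n) < e"
        using M[rule_format, OF that] by (simp add: dist_unitization_def)
      then show ?thesis using norm_scalar_part_le[of "X m - X n"] by simp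
    qed
    then show "\<exists>M. \<forall>m\<ge>M. \<forall>n\<ge>M. dist (scalar_part (X m)) (scalar_part (X n)) < e"
      by (auto simp: dist_norm)
  qed
  from convergentD[OF Cauchy_convergent[OF this]]
  obtain z where z: "(\<lambda>n. scalar_part (X n)) \<longlonglongrightarrow> z" ..
  have "(\<lambda>n. norm (alg_part (X n) - a) + cmod (scalar_part (X n) - z)) \<longlonglongrightarrow> 0 + 0"
    using a z by (intro tendsto_add tendsto_norm_zero) (simp_all add: LIM_zero)
  then have lim: "(\<lambda>n. norm (alg_part (X n) - a) + cmod (scalar_part (X n) - z)) \<longlonglongrightarrow> 0"
    by simp
  have "X \<longlonglongrightarrow> Unitization a z"
    unfolding lim_sequentially
  proof (intro allI impI)
    fix e :: real assume "e > 0"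
    with lim have "\<forall>\<^sub>F n in sequentially. norm (alg_part (X n) - a) + cmod (scalar_part (X n) - z) < e"
      by (rule order_tendstoD)
    then obtain N where "\<forall>n\<ge>N. norm (alg_part (X n) - a) + cmod (scalar_part (X n) - z) < e"
      by (auto simp: eventually_sequentially)
    then have "dist (X n) (Unitization a z) < e" if "n \<ge> N" for n
      using norm_unitization_le[of "X n - Unitization a z"] that
      by (auto simp: dist_unitization_def intro: le_less_trans)
    then show "\<exists>N. \<forall>n\<ge>N. dist (X n) (Unitization a z) < e" by blast
  qed
  then show "convergent X" by (auto simp: convergent_def)
qed

section \<open>Spectral radius of self-adjoint elements\<close>

lemma spectrum_iff: "z \<in> spectrum u \<longleftrightarrow> \<not> (\<exists>v. mutually_inverse (u - scalar z) v)"
  by (simp add: spectrum_def mutually_inverse_def)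

lemma norm_scalar [simp]: "norm (scalar z :: 'a::cstar_algebra unitization) = cmod z"
  using norm_unitization_le[of "scalar z :: 'a unitization"]
    norm_scalar_part_le[of "scalar z :: 'a unitization"] by simp

lemma scaleR_unitization: "r *\<^sub>R u = scalar (complex_of_real r) * u"
  for u :: "'a::cstar_algebra unitization"
  by (auto intro!: unitization.expand simp: scaleR_unitization_def scaleR_scaleC scaleR_conv_of_real)

lemma norm_scalar_mult [simp]:
  "norm (scalar (complex_of_real r) * u) = \<bar>r\<bar> * norm u" for u :: "'a::cstar_algebra unitization"
  by (simp add: scaleR_unitization[symmetric])

lemma mutually_inverse_scalar: "z \<noteq> 0 \<Longrightarrow> mutually_inverse (scalar z) (scalar (1 / z))"
  by (simp add: mutually_inverse_def scalar_mult[symmetric])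

text \<open>For nonzero \<open>w\<close> this is \<open>1 - w u = - w (u - 1 / w)\<close>. The case
  \<open>w = 0\<close> stands apart because \<open>1 / 0 = 0\<close> may be a spectral
  value.\<close>

lemma invertible_one_minus_scalar_mult:
  assumes "w = 0 \<or> 1 / w \<notin> spectrum u"
  shows "\<exists>v. mutually_inverse (1 - scalar w * u) v"
proof (cases "w = 0")
  case True
  then show ?thesis by (auto simp: mutually_inverse_def)
next
  case False
  then obtain v where "mutually_inverse (u - scalar (1 / w)) v"
    using assms by (auto simp: spectrum_iff)
  from mutually_inverse_mult[OF mutually_inverse_scalar this, of "- w"] False
  have "\<exists>v. mutually_inverse (scalar (- w) * (u - scalar (1 / w))) v" by auto
  moreover have "scalar (- w) * (u - scalar (1 / w)) = 1 - scalar w * u"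
    using False by (simp add: algebra_simps scalar_minus scalar_mult[symmetric])
  ultimately show ?thesis by metis
qed

lemma cmod_spectrum_le_norm:
  assumes "z \<in> spectrum u" shows "cmod z \<le> norm u"
proof (rule ccontr)
  assume *: "\<not> cmod z \<le> norm u"
  then have "z \<noteq> 0" by auto
  have "norm (scalar (1 / z) * u) \<le> norm u / cmod z"
    using norm_mult_ineq[of "scalar (1 / z)" u] by (simp add: norm_divide)
  also have "\<dots> < 1" using * \<open>z \<noteq> 0\<close> by (simp add: divide_less_eq)
  finally obtain v where "mutually_inverse (1 - scalar (1 / z) * u) v"
    using mutually_inverse_one_minus by blast
  from mutually_inverse_mult[OF mutually_inverse_scalar this, of "- z"] \<open>z \<noteq> 0\<close>
  have "\<exists>v. mutually_inverse (scalar (- z) * (1 - scalar (1 / z) * u)) v" by auto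
  moreover have "scalar (- z) * (1 - scalar (1 / z) * u) = u - scalar z"
    using \<open>z \<noteq> 0\<close>
    by (simp add: right_diff_distrib mult.assoc[symmetric] scalar_mult[symmetric] scalar_minus)
  ultimately show False using assms by (metis spectrum_iff)
qed

text \<open>If \<open>v\<close> inverts \<open>u - scalar z\<close>, then
  \<open>u - scalar z' = (u - scalar z) * (1 - v * scalar (z' - z))\<close>, and the second factor
  is inverted by a Neumann series for \<open>z'\<close> near \<open>z\<close>.\<close>

lemma closed_spectrum: "closed (spectrum u)"
  unfolding closed_open open_dist
proof
  fix z assume "z \<in> - spectrum u"
  then obtain v where v: "mutually_inverse (u - scalar z) v" by (auto simp: spectrum_iff)
  have "z' \<in> - spectrum u" if "dist z' z < 1 / (norm v + 1)" for z'
  proof -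
    have "norm (v * scalar (z' - z)) \<le> norm v * cmod (z' - z)"
      using norm_mult_ineq[of v "scalar (z' - z)"] by simp
    also have "\<dots> \<le> (norm v + 1) * cmod (z' - z)"
      by (intro mult_right_mono) auto
    also have "\<dots> < 1"
      using that by (simp add: dist_norm pos_less_divide_eq mult.commute add_nonneg_pos)
    finally obtain y where "mutually_inverse (1 - v * scalar (z' - z)) y"
      using mutually_inverse_one_minus by blast
    from mutually_inverse_mult[OF v this]
    have "\<exists>y. mutually_inverse ((u - scalar z) * (1 - v * scalar (z' - z))) y" by blast
    moreover have "(u - scalar z) * (1 - v * scalar (z' - z)) = u - scalar z'"
      using v by (simp add: right_diff_distrib mult.assoc[symmetric] mutually_inverse_def scalar_diff)
    ultimately show ?thesis by (auto simp: spectrum_iff)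
  qed
  moreover have "1 / (norm v + 1) > 0" by (simp add: add_nonneg_pos)
  ultimately show "\<exists>e>0. \<forall>z'. dist z' z < e \<longrightarrow> z' \<in> - spectrum u" by blast
qed

lemma compact_real_spectrum: "compact (real_spectrum u)"
  unfolding compact_eq_bounded_closed
proof
  show "bounded (real_spectrum u)"
    unfolding bounded_iff real_spectrum_def
    using cmod_spectrum_le_norm[of "complex_of_real _" u] by auto
  have "real_spectrum u = complex_of_real -` spectrum u"
    by (auto simp: real_spectrum_def)
  then show "closed (real_spectrum u)"
    using continuous_closed_vimage[OF closed_spectrum, of complex_of_real u] by simp
qed

text \<open>The scalar part is a unital character and vanishes on
  \<open>u - scalar (scalar_part u)\<close>. In particular every spectrum is nonempty.\<close>

lemma scalar_part_in_spectrum: "scalar_part u \<in> spectrum u"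
proof -
  have "(u - scalar (scalar_part u)) * v \<noteq> 1" for v
    by (rule notI, drule arg_cong[of _ _ scalar_part]) simp
  then show ?thesis by (simp add: spectrum_def)
qed

lemma power2_norm_le_cstar: "(norm u)\<^sup>2 \<le> norm (ustar u * u)"
  for u :: "'a::cstar_algebra unitization"
proof -
  have "(cmod (scalar_part u))\<^sup>2 = cmod (scalar_part (ustar u * u))"
    by (simp add: norm_mult power2_eq_square)
  with left_norm_ustar_mult[of u] show ?thesis
    unfolding norm_unitization_def max_def by auto
qed

lemma norm_ustar [simp]: "norm (ustar u) = norm u" for u :: "'a::cstar_algebra unitization"
proof -
  have "norm u \<le> norm (ustar u)" for u :: "'a unitization"
  proof (cases "u = 0")
    case False
    have "norm u * norm u \<le> norm (ustar u) * norm u"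
      using power2_norm_le_cstar[of u] norm_mult_ineq[of "ustar u" u]
      by (simp add: power2_eq_square)
    with False show ?thesis by (auto simp: mult_le_cancel_right)
  qed simp
  from this[of u] this[of "ustar u"] show ?thesis by simp
qed

lemma norm_power2_self_adjoint:
  fixes u :: "'a::cstar_algebra unitization"
  assumes "ustar u = u" shows "norm (u\<^sup>2) = (norm u)\<^sup>2"
  using power2_norm_le_cstar[of u] norm_power_ineq[of u 2] assms
  by (simp add: power2_eq_square)

text \<open>Squaring is the step that the C*-identity controls, hence exponents that are powers of
  two; the roots of unity used below are matched to them.\<close>

lemma norm_power_self_adjoint:
  fixes u :: "'a::cstar_algebra unitization"
  assumes "ustar u = u" shows "norm (u ^ 2 ^ k) = norm u ^ 2 ^ k"
proof (induction k)
  case (Suc k)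
  have "u ^ 2 ^ Suc k = (u ^ 2 ^ k)\<^sup>2"
    by (simp add: power_mult[symmetric] mult.commute)
  then show ?case
    using norm_power2_self_adjoint[of "u ^ 2 ^ k"] Suc assms
    by (simp add: ustar_power power_mult[symmetric] mult.commute)
qed simp

text \<open>Shifting \<open>u\<close> by \<open>\<i> l\<close> with \<open>l\<close> real changes \<open>(norm u)\<^sup>2\<close> by at most \<open>l\<^sup>2\<close>, but would
  change \<open>(cmod z)\<^sup>2\<close> by \<open>l\<^sup>2 + 2 l Im z\<close>.\<close>

lemma spectrum_self_adjoint_real:
  assumes "ustar u = u" "z \<in> spectrum u"
  shows "z \<in> \<real>"
proof (rule ccontr)
  assume "z \<notin> \<real>"
  then have im: "Im z \<noteq> 0" by (simp add: complex_is_Real_iff)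
  \<comment> \<open>Chosen so that \<open>2 * l * Im z\<close> exceeds
    \<open>(norm u)\<^sup>2\<close> by 1, whatever the sign of \<open>Im z\<close>.\<close>
  define l where "l = ((norm u)\<^sup>2 + 1) / (2 * Im z)"
  let ?s = "scalar (\<i> * complex_of_real l) :: 'a unitization"
  have "z + \<i> * complex_of_real l \<in> spectrum (u + ?s)"
    using assms(2) by (simp add: spectrum_iff scalar_add)
  then have "(cmod (z + \<i> * complex_of_real l))\<^sup>2 \<le> (norm (u + ?s))\<^sup>2"
    by (intro power_mono cmod_spectrum_le_norm) auto
  also have "\<dots> \<le> norm (ustar (u + ?s) * (u + ?s))"
    by (rule power2_norm_le_cstar)
  also have "ustar (u + ?s) * (u + ?s) = u * u + scalar (complex_of_real (l\<^sup>2))"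
    using assms(1) scalar_commute[of "\<i> * complex_of_real l" u]
    by (simp add: ustar_add ustar_scalar scalar_minus algebra_simps scalar_mult[symmetric]
        power2_eq_square)
  also have "norm \<dots> \<le> norm (u * u) + norm (scalar (complex_of_real (l\<^sup>2)) :: 'a unitization)"
    by (rule norm_triangle_ineq)
  also have "\<dots> \<le> (norm u)\<^sup>2 + l\<^sup>2"
    using norm_mult_ineq[of u u] by (simp add: power2_eq_square norm_mult)
  finally have "(Re z)\<^sup>2 + (Im z + l)\<^sup>2 \<le> (norm u)\<^sup>2 + l\<^sup>2"
    by (simp add: cmod_power2)
  then have "(Im z)\<^sup>2 + 2 * l * Im z + (Re z)\<^sup>2 \<le> (norm u)\<^sup>2"
    by (simp add: power2_sum algebra_simps)
  moreover have "2 * l * Im z = (norm u)\<^sup>2 + 1"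
    using im by (simp add: l_def)
  ultimately show False using zero_le_power2[of "Im z"] zero_le_power2[of "Re z"] by linarith
qed

text \<open>Equicontinuity of the averages over the \<open>2 ^ k\<close>-th roots of unity, by repeated use of
  \<open>(1 - a)\<^sup>-\<^sup>1 + (1 + a)\<^sup>-\<^sup>1 = 2 (1 - a\<^sup>2)\<^sup>-\<^sup>1\<close>.\<close>

lemma inverse_one_minus_power_equicontinuous:
  fixes u :: "'a::cstar_algebra unitization"
  assumes inv: "\<And>w. w \<in> cball 0 R \<Longrightarrow> mutually_inverse (1 - scalar w * u) (G w)"
    and cont: "\<And>w w'. w \<in> cball 0 R \<Longrightarrow> w' \<in> cball 0 R \<Longrightarrow> dist w w' < d \<Longrightarrow> norm (G w - G w') \<le> e"
  shows "\<exists>H. (\<forall>w\<in>cball 0 R. mutually_inverse (1 - (scalar w * u) ^ 2 ^ k) (H w)) \<and>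
    (\<forall>w\<in>cball 0 R. \<forall>w'\<in>cball 0 R. dist w w' < d \<longrightarrow> norm (H w - H w') \<le> e)"
proof (induction k)
  case 0
  show ?case using inv cont by (intro exI[of _ G]) auto
next
  case (Suc k)
  then obtain H where
    H: "\<And>w. w \<in> cball 0 R \<Longrightarrow> mutually_inverse (1 - (scalar w * u) ^ 2 ^ k) (H w)"
    and Hd: "\<And>w w'. w \<in> cball 0 R \<Longrightarrow> w' \<in> cball 0 R \<Longrightarrow> dist w w' < d \<Longrightarrow> norm (H w - H w') \<le> e"
    by blast
  \<comment> \<open>Replacing \<open>w\<close> by \<open>\<omega> * w\<close> changes the sign of
    \<open>(scalar w * u) ^ 2 ^ k\<close> and preserves the disc and all distances.\<close>
  define \<omega> where "\<omega> = cis (pi / 2 ^ k)"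
  have root: "\<omega> ^ 2 ^ k = - 1"
    by (simp add: \<omega>_def Complex.DeMoivre cis_pi)
  have unit: "cmod \<omega> = 1" by (simp add: \<omega>_def)
  \<comment> \<open>A mean of two inverses: the bound \<open>e\<close> for the same \<open>d\<close>
    is inherited without loss, so it does not depend on \<open>k\<close>.\<close>
  define H' where "H' w = (1/2) *\<^sub>R (H w + H (\<omega> * w))" for w
  have rot: "\<omega> * w \<in> cball 0 R" if "w \<in> cball 0 R" for w
    using that unit by (simp add: norm_mult)
  have "mutually_inverse (1 - (scalar w * u) ^ 2 ^ Suc k) (H' w)" if w: "w \<in> cball 0 R" for w
  proof -
    define a where "a = (scalar w * u) ^ 2 ^ k"
    have pow: "(scalar v * u) ^ n = scalar (v ^ n) * u ^ n" for v n
    proof (induction n)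
      case (Suc n)
      then show ?case
        by (simp add: scalar_mult) (metis mult.assoc scalar_commute)
    qed simp
    have "(scalar (\<omega> * w) * u) ^ 2 ^ k = - a"
      unfolding a_def pow by (simp add: power_mult_distrib root scalar_minus)
    then have p: "mutually_inverse (1 + a) (H (\<omega> * w))"
      using H[OF rot[OF w]] by simp
    have m: "mutually_inverse (1 - a) (H w)"
      using H[OF w] by (simp add: a_def)
    have sq: "(scalar w * u) ^ 2 ^ Suc k = a * a"
      by (simp add: a_def power_add[symmetric] mult_2)
    have f1: "1 - a * a = (1 + a) * (1 - a)" and f2: "1 - a * a = (1 - a) * (1 + a)"
      by (simp_all add: algebra_simps)
    have "(1 - a * a) * (H w + H (\<omega> * w)) = (1 + a) * ((1 - a) * H w) + (1 - a) * ((1 + a) * H (\<omega> * w))"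
      by (subst distrib_left) (simp only: mult.assoc[symmetric] f1[symmetric] f2[symmetric])
    moreover have "(H w + H (\<omega> * w)) * (1 - a * a) = (H w * (1 - a)) * (1 + a) + (H (\<omega> * w) * (1 + a)) * (1 - a)"
      by (subst distrib_right) (simp only: mult.assoc f1[symmetric] f2[symmetric])
    ultimately have "(1 - a * a) * (H w + H (\<omega> * w)) = 2 *\<^sub>R 1" "(H w + H (\<omega> * w)) * (1 - a * a) = 2 *\<^sub>R 1"
      using p m by (simp_all add: mutually_inverse_def scaleR_2)
    then show ?thesis
      unfolding sq H'_def mutually_inverse_def by simp
  qed
  moreover have "norm (H' w - H' w') \<le> e"
    if w: "w \<in> cball 0 R" "w' \<in> cball 0 R" and "dist w w' < d" for w w'
  proof -
    have "dist (\<omega> * w) (\<omega> * w') < d"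
      using that(3) unit by (simp add: dist_norm right_diff_distrib[symmetric] norm_mult)
    then have "norm (H w - H w') \<le> e" "norm (H (\<omega> * w) - H (\<omega> * w')) \<le> e"
      using Hd rot that by auto
    moreover have "H' w - H' w' = (1/2) *\<^sub>R ((H w - H w') + (H (\<omega> * w) - H (\<omega> * w')))"
      by (simp add: H'_def algebra_simps)
    moreover have "norm ((H w - H w') + (H (\<omega> * w) - H (\<omega> * w')))
        \<le> norm (H w - H w') + norm (H (\<omega> * w) - H (\<omega> * w'))"
      by (rule norm_triangle_ineq)
    ultimately show ?thesis by simp
  qed
  ultimately show ?case by blast
qed

text \<open>Otherwise \<open>1 - scalar w * u\<close> is invertible on the whole closed disc of
  radius \<open>1 / norm u\<close>. The inverses of \<open>1 - (scalar w * u) ^ 2 ^ k\<close> then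
  share one modulus of continuity for all \<open>k\<close>. At the boundary the power keeps norm 1
  by self-adjointness, so its inverse stays away from 1; slightly inside, the power is small for
  large \<open>k\<close> and the inverse is close to 1.\<close>

lemma spectral_radius_self_adjoint:
  assumes sa: "ustar u = u"
  shows "\<exists>z\<in>spectrum u. cmod z = norm u"
proof (cases "u = 0")
  case True
  then show ?thesis
    using scalar_part_in_spectrum[of u] by auto
next
  case False
  define R where "R = 1 / norm u"
  have R: "R > 0" using False by (simp add: R_def)
  show ?thesis
  proof (rule ccontr)
    assume none: "\<not> (\<exists>z\<in>spectrum u. cmod z = norm u)"
    have "\<exists>v. mutually_inverse (1 - scalar w * u) v" if "w \<in> cball 0 R" for w
    proof (rule invertible_one_minus_scalar_mult, rule disjCI)
      assume "\<not> 1 / w \<notin> spectrum u"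
      then have "cmod (1 / w) < norm u"
        using cmod_spectrum_le_norm none by (metis less_eq_real_def)
      moreover have "cmod w * norm u \<le> 1"
        using that False by (simp add: R_def field_simps)
      ultimately show "w = 0"
        by (cases "w = 0") (simp_all add: norm_divide divide_less_eq mult.commute)
    qed
    then obtain G where G: "\<And>w. w \<in> cball 0 R \<Longrightarrow> mutually_inverse (1 - scalar w * u) (G w)"
      by metis
    have "continuous_on (cball 0 R) (\<lambda>w. 1 - scalar w * u)"
    proof (rule continuous_onI)
      fix w e assume "e > (0::real)"
      have "norm (scalar w' * u - scalar w * u) \<le> cmod (w' - w) * norm u" for w'
        using norm_mult_ineq[of "scalar (w' - w)" u]
        by (simp only: norm_scalar) (simp add: scalar_diff left_diff_distrib)
      then have "dist w' w < e / norm u \<Longrightarrow> dist (1 - scalar w' * u) (1 - scalar w * u) \<le> e" for w'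
        using False by (auto simp: dist_norm norm_minus_commute pos_less_divide_eq
            intro: order_trans less_imp_le)
      with \<open>e > 0\<close> False
      show "\<exists>d>0. \<forall>w'\<in>cball 0 R. dist w' w < d \<longrightarrow> dist (1 - scalar w' * u) (1 - scalar w * u) \<le> e"
        by (intro exI[of _ "e / norm u"]) auto
    qed
    then have "continuous_on (cball 0 R) G"
      using G by (rule continuous_on_inverse_elem)
    then have "uniformly_continuous_on (cball 0 R) G"
      by (rule compact_uniformly_continuous) simp
    \<comment> \<open>Below, the inverse is at distance at least 1/2 from 1 at \<open>w\<close> and
      at most 1/4 at \<open>w'\<close>; any variation below 1/4 contradicts this.\<close>
    from uniformly_continuous_onE[OF this, of "1/8"] obtain d where d: "d > 0"
      and Gd: "\<And>w w'. w \<in> cball 0 R \<Longrightarrow> w' \<in> cball 0 R \<Longrightarrow> dist w' w < d \<Longrightarrow> dist (G w') (G w) < 1/8"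
      by auto
    have Gd': "norm (G w - G w') \<le> 1/8"
      if "w \<in> cball 0 R" "w' \<in> cball 0 R" "dist w w' < d" for w w'
      using Gd[OF that(2,1,3)] by (simp add: dist_norm)
    \<comment> \<open>Close enough to 1 that \<open>(1 - \<rho>) * R \<le> d / 2\<close>; the
      maximum with 1/2 keeps it positive.\<close>
    define \<rho> where "\<rho> = max (1/2) (1 - d / (2 * R))"
    have \<rho>: "0 < \<rho>" "\<rho> < 1" using d R by (auto simp: \<rho>_def)
    have "1 - \<rho> \<le> d / (2 * R)" by (simp add: \<rho>_def)
    then have close: "(1 - \<rho>) * R < d"
      using d R by (simp add: field_simps)
    \<comment> \<open>With \<open>norm V \<le> 1/5\<close>, the distance \<open>n\<close> of
      \<open>H w'\<close> from 1 satisfies \<open>n \<le> (n + 1) / 5\<close>, hence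
      \<open>n \<le> 1/4\<close>.\<close>
    obtain k where k: "\<rho> ^ k < 1/5"
      using real_arch_pow_inv[of "1/5" \<rho>] \<rho> by auto
    from inverse_one_minus_power_equicontinuous[where k = k, OF G Gd']
    obtain H where
      H: "\<And>w. w \<in> cball 0 R \<Longrightarrow> mutually_inverse (1 - (scalar w * u) ^ 2 ^ k) (H w)"
      and Hd: "\<And>w w'. w \<in> cball 0 R \<Longrightarrow> w' \<in> cball 0 R \<Longrightarrow> dist w w' < d \<Longrightarrow> norm (H w - H w') \<le> 1/8"
      by blast
    define w w' where "w = complex_of_real R" and "w' = complex_of_real (\<rho> * R)"
    have "\<rho> * R \<le> 1 * R"
      using \<rho> R by (intro mult_right_mono) auto
    then have ww: "w \<in> cball 0 R" "w' \<in> cball 0 R"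
      using \<rho> R by (auto simp: w_def w'_def abs_mult simp del: of_real_mult)
    have "w - w' = complex_of_real ((1 - \<rho>) * R)"
      by (simp add: w_def w'_def algebra_simps)
    then have "cmod (w - w') = (1 - \<rho>) * R"
      using \<rho> R by (simp only: norm_of_real) (simp add: abs_mult)
    then have near: "norm (H w - H w') \<le> 1/8"
      using close by (intro Hd ww) (simp add: dist_norm)
    define U V where "U = (scalar w * u) ^ 2 ^ k" and "V = (scalar w' * u) ^ 2 ^ k"
    have "norm (scalar w * u) = 1"
      using R False by (simp add: w_def) (simp add: R_def)
    moreover have "ustar (scalar w * u) = scalar w * u"
      by (simp add: ustar_mult sa ustar_scalar w_def scalar_commute)
    ultimately have nU: "norm U = 1"
      unfolding U_def by (simp add: norm_power_self_adjoint)
    have "norm (scalar w' * u) = \<rho>"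
      using \<rho> R False by (simp add: w'_def abs_mult del: of_real_mult) (simp add: R_def)
    then have "norm V \<le> \<rho> ^ 2 ^ k"
      unfolding V_def by (metis norm_power_ineq)
    also have "\<dots> \<le> \<rho> ^ k"
      using \<rho> by (intro power_decreasing) (auto intro: less_imp_le)
    finally have nV: "norm V \<le> 1/5" using k by simp
    have "H w' - 1 = V * H w'"
      using H[OF ww(2)] by (simp add: mutually_inverse_def V_def algebra_simps)
    then have "norm (H w' - 1) \<le> norm V * norm (H w')"
      by (metis norm_mult_ineq)
    also have "\<dots> \<le> 1/5 * norm (H w')"
      using nV by (intro mult_right_mono) auto
    finally have "norm (H w' - 1) \<le> 1/5 * norm (H w')" .
    moreover have "norm (H w') \<le> norm (H w' - 1) + 1"
      using norm_triangle_sub[of "H w'" 1] by simp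
    ultimately have far: "norm (H w' - 1) \<le> 1/4" by linarith
    have "U = (H w - 1) * (1 - U)"
      using H[OF ww(1)] by (simp add: mutually_inverse_def U_def algebra_simps)
    then have "norm U \<le> norm (H w - 1) * norm (1 - U)"
      by (metis norm_mult_ineq)
    also have "\<dots> \<le> norm (H w - 1) * 2"
      using norm_triangle_ineq4[of 1 U] nU by (intro mult_left_mono) auto
    finally have "norm (H w - 1) \<ge> 1/2" using nU by simp
    moreover have "norm (H w - 1) \<le> norm (H w - H w') + norm (H w' - 1)"
      using norm_triangle_ineq[of "H w - H w'" "H w' - 1"] by simp
    ultimately show False using near far by linarith
  qed
qed

section \<open>Continuous functional calculus\<close>

text \<open>Complex coefficients make factorisation into linear factors available;
  \<open>poly_eval\<close> is reduced to this evaluation.\<close>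

definition cpoly_eval :: "complex poly \<Rightarrow> 'a::cstar_algebra unitization \<Rightarrow> 'a unitization" where
  "cpoly_eval p u = (\<Sum>i\<le>degree p. scalar (coeff p i) * u ^ i)"

lemma cpoly_eval_eq_sum:
  assumes "degree p \<le> n"
  shows "cpoly_eval p u = (\<Sum>i\<le>n. scalar (coeff p i) * u ^ i)"
  unfolding cpoly_eval_def
  by (rule sum.mono_neutral_left) (use assms in \<open>auto simp: coeff_eq_0\<close>)

lemma cpoly_eval_0 [simp]: "cpoly_eval 0 u = 0"
  by (simp add: cpoly_eval_def)

lemma cpoly_eval_pCons: "cpoly_eval (pCons a p) u = scalar a + u * cpoly_eval p u"
proof -
  have "cpoly_eval (pCons a p) u = (\<Sum>i\<le>Suc (degree p). scalar (coeff (pCons a p) i) * u ^ i)"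
    by (rule cpoly_eval_eq_sum) (simp add: degree_pCons_le)
  also have "\<dots> = scalar a + (\<Sum>i\<le>degree p. scalar (coeff p i) * u ^ Suc i)"
    by (subst sum.atMost_Suc_shift) simp
  also have "\<dots> = scalar a + u * cpoly_eval p u"
    by (simp add: cpoly_eval_def sum_distrib_left mult.assoc[symmetric] scalar_commute[of _ u])
  finally show ?thesis .
qed

lemma cpoly_eval_const [simp]: "cpoly_eval [:a:] u = scalar a"
  by (simp add: cpoly_eval_pCons)

lemma cpoly_eval_add: "cpoly_eval (p + q) u = cpoly_eval p u + cpoly_eval q u"
proof (induction p arbitrary: q)
  case (pCons a p)
  then show ?case
    by (cases q) (simp add: cpoly_eval_pCons scalar_add algebra_simps)
qed simp

lemma cpoly_eval_smult: "cpoly_eval (smult a p) u = scalar a * cpoly_eval p u"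
proof (induction p)
  case (pCons b p)
  then show ?case
    by (simp add: cpoly_eval_pCons scalar_mult distrib_left mult.assoc[symmetric] scalar_commute[of a u])
qed simp

lemma cpoly_eval_diff: "cpoly_eval (p - q) u = cpoly_eval p u - cpoly_eval q u"
  using cpoly_eval_add[of "p - q" q u] by simp

lemma cpoly_eval_mult: "cpoly_eval (p * q) u = cpoly_eval p u * cpoly_eval q u"
proof (induction p)
  case (pCons a p)
  then show ?case
    by (simp add: cpoly_eval_pCons cpoly_eval_add cpoly_eval_smult distrib_right mult.assoc)
qed simp

lemma cpoly_eval_commute:
  assumes "x * u = u * x" shows "x * cpoly_eval p u = cpoly_eval p u * x"
proof (induction p)
  case (pCons a p)
  have "x * (u * cpoly_eval p u) = u * cpoly_eval p u * x"
    using pCons assms by (metis mult.assoc)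
  then show ?case
    by (simp add: cpoly_eval_pCons distrib_left distrib_right scalar_commute)
qed simp

text \<open>Split off a root \<open>r\<close> of \<open>q\<close>: the factor
  \<open>u - scalar r\<close> is invertible because \<open>r\<close> lies outside the
  spectrum.\<close>

lemma cpoly_eval_invertible:
  assumes "q \<noteq> 0" "\<And>t. poly q t = 0 \<Longrightarrow> t \<notin> spectrum u"
  shows "\<exists>v. mutually_inverse (cpoly_eval q u) v"
  using assms
proof (induction "degree q" arbitrary: q)
  case 0
  then obtain a where "q = [:a:]" by (metis degree_eq_zeroE)
  with 0 show ?case using mutually_inverse_scalar[of a] by auto
next
  case (Suc n)
  then have "\<not> constant (poly q)" by (simp add: constant_degree)
  then obtain r where r: "poly q r = 0" using fundamental_theorem_of_algebra by blast
  then obtain q' where q': "q = [:- r, 1:] * q'" by (auto simp: poly_eq_0_iff_dvd)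
  with Suc have "q' \<noteq> 0" by auto
  then have "degree q = Suc (degree q')"
    unfolding q' by (subst degree_mult_eq) auto
  with Suc \<open>q' \<noteq> 0\<close> have "\<exists>v. mutually_inverse (cpoly_eval q' u) v"
    by (intro Suc(1)) (auto simp: q')
  moreover have "\<exists>v. mutually_inverse (u - scalar r) v"
    using Suc(4)[OF r] by (simp add: spectrum_iff)
  moreover have "cpoly_eval q u = (u - scalar r) * cpoly_eval q' u"
    unfolding q' cpoly_eval_mult by (simp add: cpoly_eval_pCons scalar_minus)
  ultimately show ?case using mutually_inverse_mult by metis
qed

lemma spectrum_cpoly_eval:
  assumes "z \<in> spectrum (cpoly_eval p u)"
  shows "\<exists>t\<in>spectrum u. z = poly p t"
proof (cases "p = [:z:]")
  \<comment> \<open>Here \<open>p - [:z:]\<close> is zero and has no factorisation; any spectral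
    value serves as \<open>t\<close>.\<close>
  case True
  then show ?thesis using scalar_part_in_spectrum[of u] by auto
next
  case False
  have "\<not> (\<exists>v. mutually_inverse (cpoly_eval (p - [:z:]) u) v)"
    using assms by (simp add: spectrum_iff cpoly_eval_diff)
  then obtain t where "poly (p - [:z:]) t = 0" "t \<in> spectrum u"
    using cpoly_eval_invertible[of "p - [:z:]" u] False by auto
  then show ?thesis by auto
qed

abbreviation of_real_poly :: "real poly \<Rightarrow> complex poly" where
  "of_real_poly \<equiv> map_poly complex_of_real"

lemma poly_eval_eq: "poly_eval p u = cpoly_eval (of_real_poly p) u"
  by (simp add: poly_eval_def cpoly_eval_def degree_map_poly coeff_map_poly)

lemma poly_of_real_poly: "poly (of_real_poly p) (complex_of_real t) = complex_of_real (poly p t)"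
  by (induction p) (simp_all add: map_poly_pCons)

lemma of_real_poly_diff: "of_real_poly (p - q) = of_real_poly p - of_real_poly q"
  by (rule poly_eqI) (simp add: coeff_map_poly)

lemma of_real_poly_mult: "of_real_poly (p * q) = of_real_poly p * of_real_poly q"
  by (rule poly_eqI) (simp add: coeff_map_poly coeff_mult)

lemma poly_eval_diff: "poly_eval (p - q) u = poly_eval p u - poly_eval q u"
  and poly_eval_mult: "poly_eval (p * q) u = poly_eval p u * poly_eval q u"
  by (simp_all add: poly_eval_eq of_real_poly_diff of_real_poly_mult
      cpoly_eval_diff cpoly_eval_mult)

lemma poly_eval_const [simp]: "poly_eval [:a:] u = scalar (complex_of_real a)"
  by (simp add: poly_eval_eq map_poly_pCons)

lemma poly_eval_ident [simp]: "poly_eval [:0, 1:] u = u"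
  by (simp add: poly_eval_eq map_poly_pCons cpoly_eval_pCons)

lemma ustar_poly_eval: "ustar u = u \<Longrightarrow> ustar (poly_eval p u) = poly_eval p u"
  by (simp add: poly_eval_def ustar_sum ustar_mult ustar_power ustar_scalar scalar_commute)

lemma spectrum_self_adjoint:
  assumes "ustar u = u" shows "spectrum u = complex_of_real ` real_spectrum u"
  using spectrum_self_adjoint_real[OF assms]
  by (auto simp: real_spectrum_def elim!: Reals_cases)

text \<open>\<open>poly_eval p u\<close> is self-adjoint, so its norm is the modulus of a spectral
  value, which by factorisation is \<open>p\<close> at a point of the real spectrum of
  \<open>u\<close>.\<close>

lemma norm_poly_eval_le:
  assumes sa: "ustar u = u" and B: "\<And>t. t \<in> real_spectrum u \<Longrightarrow> \<bar>poly p t\<bar> \<le> B"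
  shows "norm (poly_eval p u) \<le> B"
proof -
  obtain z where z: "z \<in> spectrum (poly_eval p u)" "cmod z = norm (poly_eval p u)"
    using spectral_radius_self_adjoint[OF ustar_poly_eval[OF sa]] by blast
  then obtain s where s: "s \<in> spectrum u" "z = poly (of_real_poly p) s"
    using spectrum_cpoly_eval unfolding poly_eval_eq by blast
  then obtain t where "t \<in> real_spectrum u" "s = complex_of_real t"
    using spectrum_self_adjoint[OF sa] by auto
  with s z(2) B[of t] show ?thesis by (simp add: poly_of_real_poly)
qed

section \<open>Continuous functions as uniform limits of polynomials\<close>

lemma tendsto_unitization_iff:
  fixes X :: "nat \<Rightarrow> 'a::cstar_algebra unitization"
  shows "X \<longlonglongrightarrow> v \<longleftrightarrow>
    (\<lambda>n. alg_part (X n)) \<longlonglongrightarrow> alg_part v \<and> (\<lambda>n. scalar_part (X n)) \<longlonglongrightarrow> scalar_part v"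
proof (intro iffI conjI; (elim conjE)?)
  assume X: "X \<longlonglongrightarrow> v"
  then have 0: "(\<lambda>n. norm (X n - v)) \<longlonglongrightarrow> 0"
    by (intro tendsto_norm_zero) (simp add: LIM_zero)
  have "(\<lambda>n. alg_part (X n) - alg_part v) \<longlonglongrightarrow> 0"
    by (rule Lim_null_comparison[OF _ tendsto_mult_right_zero[OF 0, of 2]])
      (use norm_alg_part_le_norm[of "X _ - v"] in auto)
  then show "(\<lambda>n. alg_part (X n)) \<longlonglongrightarrow> alg_part v" by (simp add: LIM_zero_iff)
  have "(\<lambda>n. scalar_part (X n) - scalar_part v) \<longlonglongrightarrow> 0"
    by (rule Lim_null_comparison[OF _ 0]) (use norm_scalar_part_le[of "X _ - v"] in auto)
  then show "(\<lambda>n. scalar_part (X n)) \<longlonglongrightarrow> scalar_part v" by (simp add: LIM_zero_iff)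
next
  assume a: "(\<lambda>n. alg_part (X n)) \<longlonglongrightarrow> alg_part v"
    and s: "(\<lambda>n. scalar_part (X n)) \<longlonglongrightarrow> scalar_part v"
  have "(\<lambda>n. norm (alg_part (X n) - alg_part v)) \<longlonglongrightarrow> 0"
    using a by (intro tendsto_norm_zero) (simp add: LIM_zero)
  moreover have "(\<lambda>n. cmod (scalar_part (X n) - scalar_part v)) \<longlonglongrightarrow> 0"
    using s by (intro tendsto_norm_zero) (simp add: LIM_zero)
  ultimately have "(\<lambda>n. norm (alg_part (X n) - alg_part v) + cmod (scalar_part (X n) - scalar_part v))
      \<longlonglongrightarrow> 0"
    using tendsto_add_zero by blast
  then have "(\<lambda>n. X n - v) \<longlonglongrightarrow> 0"
    by (rule Lim_null_comparison[rotated]) (use norm_unitization_le[of "X _ - v"] in auto)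
  then show "X \<longlonglongrightarrow> v" by (simp add: LIM_zero_iff)
qed

text \<open>A relational form of \<open>cfc\<close>: algebraic rules are proved on approximating
  sequences, and uniqueness transfers them to the definite description.\<close>

definition is_cfc :: "(real \<Rightarrow> real) \<Rightarrow> 'a::cstar_algebra unitization \<Rightarrow> 'a unitization \<Rightarrow> bool" where
  "is_cfc g u v \<longleftrightarrow> (\<exists>p. uniform_limit (real_spectrum u) (\<lambda>n. poly (p n)) g sequentially \<and>
     (\<lambda>n. poly_eval (p n) u) \<longlonglongrightarrow> v)"

lemma cfc_eq_The: "cfc g u = (THE v. is_cfc g u v)"
  unfolding cfc_def is_cfc_def tendsto_unitization_iff ..

lemma is_cfc_unique:
  assumes sa: "ustar u = u" and "is_cfc g u v" "is_cfc g u w"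
  shows "v = w"
proof -
  obtain p where p: "uniform_limit (real_spectrum u) (\<lambda>n. poly (p n)) g sequentially"
    "(\<lambda>n. poly_eval (p n) u) \<longlonglongrightarrow> v"
    using assms by (auto simp: is_cfc_def)
  obtain q where q: "uniform_limit (real_spectrum u) (\<lambda>n. poly (q n)) g sequentially"
    "(\<lambda>n. poly_eval (q n) u) \<longlonglongrightarrow> w"
    using assms by (auto simp: is_cfc_def)
  have "uniform_limit (real_spectrum u) (\<lambda>n t. poly (p n) t - poly (q n) t) (\<lambda>t. g t - g t) sequentially"
    by (intro uniform_limit_minus p q)
  then have u: "uniform_limit (real_spectrum u) (\<lambda>n. poly (p n - q n)) (\<lambda>_. 0) sequentially"
    by (simp add: poly_diff[abs_def])
  have "(\<lambda>n. poly_eval (p n - q n) u) \<longlonglongrightarrow> 0"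
  proof (rule tendstoI)
    fix e :: real assume "e > 0"
    then have "\<forall>\<^sub>F n in sequentially. \<forall>t\<in>real_spectrum u. dist (poly (p n - q n) t) 0 < e / 2"
      using uniform_limitD[OF u, of "e / 2"] by simp
    then show "\<forall>\<^sub>F n in sequentially. dist (poly_eval (p n - q n) u) 0 < e"
    proof eventually_elim
      case (elim n)
      then have "norm (poly_eval (p n - q n) u) \<le> e / 2"
        by (intro norm_poly_eval_le[OF sa]) (auto simp: less_imp_le)
      with \<open>e > 0\<close> show ?case by simp
    qed
  qed
  moreover have "(\<lambda>n. poly_eval (p n - q n) u) \<longlonglongrightarrow> v - w"
    unfolding poly_eval_diff by (intro tendsto_diff p q)
  ultimately have "v - w = 0" by (rule LIMSEQ_unique[rotated])
  then show ?thesis by simp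
qed

lemma is_cfc_cfc_eq: "ustar u = u \<Longrightarrow> is_cfc g u v \<Longrightarrow> cfc g u = v"
  unfolding cfc_eq_The by (rule the_equality) (simp, rule is_cfc_unique)

text \<open>Stone-Weierstrass on the compact spectrum gives the polynomials; the norm bound makes
  their values at \<open>u\<close> a Cauchy sequence in a complete space.\<close>

lemma is_cfc_exists:
  assumes sa: "ustar u = u" and g: "continuous_on (real_spectrum u) g"
  shows "\<exists>v. is_cfc g u v"
proof -
  have "\<exists>p. \<forall>t\<in>real_spectrum u. \<bar>g t - poly p t\<bar> < inverse (real (Suc n))" for n
  proof -
    obtain h where h: "real_polynomial_function h"
      "\<And>t. t \<in> real_spectrum u \<Longrightarrow> \<bar>g t - h t\<bar> < inverse (real (Suc n))"
      by (rule Stone_Weierstrass_real_polynomial_function[OF compact_real_spectrum g,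
            of "inverse (real (Suc n))"]) auto
    then obtain a m where "h = (\<lambda>t. \<Sum>i\<le>m. a i * t ^ i)"
      by (auto simp: real_polynomial_function_iff_sum)
    then have "poly (\<Sum>i\<le>m. monom (a i) i) = h"
      by (simp add: fun_eq_iff poly_sum poly_monom)
    with h show ?thesis by metis
  qed
  then obtain p where p: "\<And>n t. t \<in> real_spectrum u \<Longrightarrow> \<bar>g t - poly (p n) t\<bar> < inverse (real (Suc n))"
    by metis
  have lim: "uniform_limit (real_spectrum u) (\<lambda>n. poly (p n)) g sequentially"
  proof (rule uniform_limitI)
    fix e :: real assume "e > 0"
    then have "\<forall>\<^sub>F n in sequentially. inverse (real (Suc n)) < e"
      using LIMSEQ_inverse_real_of_nat by (rule order_tendstoD[rotated])
    then show "\<forall>\<^sub>F n in sequentially. \<forall>t\<in>real_spectrum u. dist (poly (p n) t) (g t) < e"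
    proof eventually_elim
      case (elim n)
      show ?case
        using less_trans[OF p elim] by (auto simp: dist_real_def abs_minus_commute)
    qed
  qed
  have "Cauchy (\<lambda>n. poly_eval (p n) u)"
  proof (rule metric_CauchyI)
    fix e :: real assume "e > 0"
    then obtain N where N: "inverse (real (Suc N)) < e / 2"
      using reals_Archimedean[of "e / 2"] by auto
    have "dist (poly_eval (p m) u) (poly_eval (p n) u) < e" if "m \<ge> N" "n \<ge> N" for m n
    proof -
      have "norm (poly_eval (p m - p n) u) \<le> 2 * inverse (real (Suc N))"
      proof (rule norm_poly_eval_le[OF sa])
        fix t assume t: "t \<in> real_spectrum u"
        have "inverse (real (Suc k)) \<le> inverse (real (Suc N))" if "k \<ge> N" for k
          using that by (intro le_imp_inverse_le) auto
        then have "\<bar>g t - poly (p m) t\<bar> < inverse (real (Suc N))" "\<bar>g t - poly (p n) t\<bar> < inverse (real (Suc N))"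
          using p[OF t] that less_le_trans by blast+
        then show "\<bar>poly (p m - p n) t\<bar> \<le> 2 * inverse (real (Suc N))"
          by simp
      qed
      with N show ?thesis by (simp add: dist_norm poly_eval_diff)
    qed
    then show "\<exists>N. \<forall>m\<ge>N. \<forall>n\<ge>N. dist (poly_eval (p m) u) (poly_eval (p n) u) < e" by blast
  qed
  then obtain v where "(\<lambda>n. poly_eval (p n) u) \<longlonglongrightarrow> v"
    using Cauchy_convergent_iff convergent_def by metis
  with lim show ?thesis unfolding is_cfc_def by blast
qed

lemma is_cfc_cfc:
  "ustar u = u \<Longrightarrow> continuous_on (real_spectrum u) g \<Longrightarrow> is_cfc g u (cfc g u)"
  using is_cfc_exists is_cfc_cfc_eq by fastforce

lemma is_cfc_diff:
  assumes "is_cfc g u v" "is_cfc h u w" shows "is_cfc (\<lambda>t. g t - h t) u (v - w)"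
proof -
  obtain p q where "uniform_limit (real_spectrum u) (\<lambda>n. poly (p n)) g sequentially"
    "(\<lambda>n. poly_eval (p n) u) \<longlonglongrightarrow> v"
    "uniform_limit (real_spectrum u) (\<lambda>n. poly (q n)) h sequentially"
    "(\<lambda>n. poly_eval (q n) u) \<longlonglongrightarrow> w"
    using assms by (auto simp: is_cfc_def)
  then show ?thesis unfolding is_cfc_def
    by (intro exI[of _ "\<lambda>n. p n - q n"])
      (simp add: poly_eval_diff poly_diff[abs_def] tendsto_diff uniform_limit_minus)
qed

text \<open>Uniform limits multiply when the limits are bounded; continuity on the compact spectrum
  provides that.\<close>

lemma is_cfc_mult:
  assumes "is_cfc g u v" "is_cfc h u w"
    and "continuous_on (real_spectrum u) g" "continuous_on (real_spectrum u) h"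
  shows "is_cfc (\<lambda>t. g t * h t) u (v * w)"
proof -
  obtain p q where "uniform_limit (real_spectrum u) (\<lambda>n. poly (p n)) g sequentially"
    "(\<lambda>n. poly_eval (p n) u) \<longlonglongrightarrow> v"
    "uniform_limit (real_spectrum u) (\<lambda>n. poly (q n)) h sequentially"
    "(\<lambda>n. poly_eval (q n) u) \<longlonglongrightarrow> w"
    using assms by (auto simp: is_cfc_def)
  moreover have "bounded (g ` real_spectrum u)" "bounded (h ` real_spectrum u)"
    using assms by (auto intro!: compact_imp_bounded compact_continuous_image compact_real_spectrum)
  ultimately show ?thesis unfolding is_cfc_def
    by (intro exI[of _ "\<lambda>n. p n * q n"])
      (simp add: poly_eval_mult poly_mult[abs_def] tendsto_mult uniform_lim_mult)
qed

lemma is_cfc_const: "is_cfc (\<lambda>_. a) u (scalar (complex_of_real a))"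
  unfolding is_cfc_def
  by (intro exI[of _ "\<lambda>_. [:a:]"]) (auto intro!: uniform_limitI)

lemma is_cfc_ident: "is_cfc (\<lambda>t. t) u u"
  unfolding is_cfc_def
  by (intro exI[of _ "\<lambda>_. [:0, 1:]"]) (auto intro!: uniform_limitI)

lemma is_cfc_cong:
  assumes "is_cfc g u v" "\<And>t. t \<in> real_spectrum u \<Longrightarrow> g t = h t"
  shows "is_cfc h u v"
proof -
  have "uniform_limit (real_spectrum u) (\<lambda>n. poly (p n)) g sequentially \<longleftrightarrow>
      uniform_limit (real_spectrum u) (\<lambda>n. poly (p n)) h sequentially" for p
    by (rule uniform_limit_cong') (use assms(2) in auto)
  with assms(1) show ?thesis by (simp add: is_cfc_def)
qed

lemma is_cfc_self_adjoint:
  assumes sa: "ustar u = u" and "is_cfc g u v" shows "ustar v = v"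
proof -
  obtain p where p: "(\<lambda>n. poly_eval (p n) u) \<longlonglongrightarrow> v"
    using assms by (auto simp: is_cfc_def)
  then have "(\<lambda>n. norm (poly_eval (p n) u - v)) \<longlonglongrightarrow> 0"
    by (intro tendsto_norm_zero) (simp add: LIM_zero)
  then have "(\<lambda>n. norm (ustar (poly_eval (p n) u - v))) \<longlonglongrightarrow> 0"
    by (simp only: norm_ustar)
  then have "(\<lambda>n. ustar (poly_eval (p n) u - v)) \<longlonglongrightarrow> 0"
    by (rule tendsto_norm_zero_cancel)
  then have "(\<lambda>n. poly_eval (p n) u) \<longlonglongrightarrow> ustar v"
    by (simp add: ustar_diff ustar_poly_eval[OF sa] LIM_zero_iff)
  with p show ?thesis using LIMSEQ_unique by blast
qed

lemma is_cfc_commute: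
  assumes "is_cfc g u v" "x * u = u * x" shows "x * v = v * x"
proof -
  obtain p where p: "(\<lambda>n. poly_eval (p n) u) \<longlonglongrightarrow> v"
    using assms by (auto simp: is_cfc_def)
  have "(\<lambda>n. x * poly_eval (p n) u) \<longlonglongrightarrow> x * v" "(\<lambda>n. poly_eval (p n) u * x) \<longlonglongrightarrow> v * x"
    by (intro tendsto_intros p)+
  moreover have "x * poly_eval (p n) u = poly_eval (p n) u * x" for n
    unfolding poly_eval_eq by (rule cpoly_eval_commute[OF assms(2)])
  ultimately show ?thesis using LIMSEQ_unique by fastforce
qed

text \<open>If \<open>g\<close> omits \<open>s\<close> on the spectrum of \<open>u\<close>, then
  \<open>1 / (g t - s)\<close> is continuous there and its value at \<open>u\<close> inverts
  \<open>v - s\<close>. This places the spectra of \<open>f c\<close> and \<open>f c - c\<close> in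
  the positive reals.\<close>

lemma real_spectrum_cfc:
  assumes sa: "ustar u = u" and g: "continuous_on (real_spectrum u) g" and "is_cfc g u v"
  shows "real_spectrum v \<subseteq> g ` real_spectrum u"
proof
  fix s assume s: "s \<in> real_spectrum v"
  show "s \<in> g ` real_spectrum u"
  proof (rule ccontr)
    assume ns: "s \<notin> g ` real_spectrum u"
    define h where "h t = 1 / (g t - s)" for t
    have h: "continuous_on (real_spectrum u) h"
      unfolding h_def using ns by (intro continuous_intros g) auto
    obtain w where w: "is_cfc h u w" using is_cfc_exists[OF sa h] by blast
    have d: "is_cfc (\<lambda>t. g t - s) u (v - scalar (complex_of_real s))"
      by (intro is_cfc_diff is_cfc_const assms)
    have dc: "continuous_on (real_spectrum u) (\<lambda>t. g t - s)"
      by (intro continuous_intros g)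
    have eq: "1 = (g t - s) * h t" "1 = h t * (g t - s)" if "t \<in> real_spectrum u" for t
      using that ns by (auto simp: h_def)
    have "is_cfc (\<lambda>_. 1) u ((v - scalar (complex_of_real s)) * w)"
      "is_cfc (\<lambda>_. 1) u (w * (v - scalar (complex_of_real s)))"
      using is_cfc_cong[OF is_cfc_mult[OF d w dc h] eq(1)[symmetric]]
        is_cfc_cong[OF is_cfc_mult[OF w d h dc] eq(2)[symmetric]] by simp_all
    then have "mutually_inverse (v - scalar (complex_of_real s)) w"
      using is_cfc_unique[OF sa _ is_cfc_const[of 1 u]]
      by (simp add: mutually_inverse_def)
    with s show False by (auto simp: real_spectrum_def spectrum_iff)
  qed
qed

section \<open>Hilbert modules over the unitization\<close>

text \<open>The spectrum must avoid 0: since \<open>0 powr s = 0\<close>, negative powers, and the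
  power 0, jump there.\<close>

lemma is_cfc_cpow:
  assumes "ustar w = w" "real_spectrum w \<subseteq> {0<..}"
  shows "is_cfc (\<lambda>t. t powr s) w (cpow w s)"
  unfolding cpow_def
  by (intro is_cfc_cfc assms continuous_intros) (use assms in auto)

lemma cpow_mult:
  assumes "ustar w = w" "real_spectrum w \<subseteq> {0<..}"
  shows "cpow w s * cpow w r = cpow w (s + r)"
proof -
  have "continuous_on (real_spectrum w) (\<lambda>t. t powr q)" for q
    by (intro continuous_intros) (use assms in auto)
  then have "is_cfc (\<lambda>t. t powr s * t powr r) w (cpow w s * cpow w r)"
    by (intro is_cfc_mult is_cfc_cpow assms)
  then show ?thesis
    unfolding powr_add[symmetric] using assms is_cfc_unique is_cfc_cpow by blast
qed

lemma cpow_one: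
  assumes "ustar w = w" "real_spectrum w \<subseteq> {0<..}" shows "cpow w 1 = w"
  by (rule is_cfc_unique[OF assms(1) is_cfc_cpow[OF assms]], rule is_cfc_cong[OF is_cfc_ident])
    (use assms in force)

lemma cpow_zero:
  assumes "ustar w = w" "real_spectrum w \<subseteq> {0<..}" shows "cpow w 0 = 1"
proof -
  have "is_cfc (\<lambda>t. t powr 0) w (scalar (complex_of_real 1))"
    by (rule is_cfc_cong[OF is_cfc_const]) (use assms in force)
  with is_cfc_unique[OF assms(1) is_cfc_cpow[OF assms]] show ?thesis by fastforce
qed

lemma cpow_half_power2:
  assumes "positive_elem u" shows "(cpow u (1/2))\<^sup>2 = u"
proof -
  have sa: "ustar u = u" and nonneg: "real_spectrum u \<subseteq> {0..}"
    using assms by (auto simp: positive_elem_def real_spectrum_def)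
  \<comment> \<open>Now 0 may be spectral, but for a positive exponent the value
    \<open>0 powr (1/2) = 0\<close> is the continuous one.\<close>
  have cont: "continuous_on (real_spectrum u) (\<lambda>t. t powr (1/2))"
    by (rule continuous_on_powr') (use nonneg in \<open>auto intro!: continuous_intros\<close>)
  have "is_cfc (\<lambda>t. t powr (1/2) * t powr (1/2)) u (cpow u (1/2) * cpow u (1/2))"
    unfolding cpow_def by (intro is_cfc_mult is_cfc_cfc sa cont)
  then have "is_cfc (\<lambda>t. t) u (cpow u (1/2) * cpow u (1/2))"
    by (rule is_cfc_cong) (use nonneg in \<open>auto simp: powr_add[symmetric]\<close>)
  then show ?thesis
    using is_cfc_unique[OF sa _ is_cfc_ident] by (simp add: power2_eq_square)
qed

section \<open>Inner products under the action of the unitization\<close>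

context hilbert_module
begin

lemma act_zero_right: "act x 0 = 0"
  using act_add_right[of x 0 0] by simp

lemma uact_one: "uact act x 1 = x"
  by (simp add: uact_def act_zero_right scaleC_one)

lemma uact_mult: "uact act x (u * v) = uact act (uact act x u) v"
  by (simp add: uact_def act_add_right act_add_left act_mult act_scaleC_left act_scaleC_right
      scaleC_add_right scaleC_scaleC mult.commute)

lemma ip_diff_right: "ip x (y - z) = ip x y - ip x z"
  using ip_add_right[of x "y - z" z] by simp

lemma ip_diff_left: "ip (x - y) z = ip x z - ip y z"
  by (metis ip_diff_right star_ip star_diff)

lemma emb_ip_uact_right: "emb (ip x (uact act y u)) = emb (ip x y) * u"
  by (auto intro!: unitization.expand
      simp: uact_def ip_add_right ip_act_right ip_scaleC_right)

lemma emb_ip_uact_left: "emb (ip (uact act x u) y) = ustar u * emb (ip x y)"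
proof -
  have "ustar (emb (ip y (uact act x u))) = ustar (emb (ip y x) * u)"
    by (simp only: emb_ip_uact_right)
  then show ?thesis by (simp add: ustar_mult ustar_emb star_ip)
qed

lemma modulus_power2: "(modulus ip x)\<^sup>2 = emb (ip x x)"
  unfolding modulus_def by (rule cpow_half_power2[OF ip_positive])

text \<open>Applied twice, with \<open>a\<close> and \<open>b\<close> the powers -1/2 and 1/2 of
  \<open>f c - c\<close> and then of \<open>f c\<close>. Centrality and \<open>a * b = 1\<close>
  free the cross terms of \<open>a\<close> and \<open>b\<close>, so both expansions have the same
  ones and these cancel.\<close>

lemma emb_ip_uact_diff:
  assumes a: "ustar a = a" "\<And>v. a * v = v * a" and b: "ustar b = b" "\<And>v. b * v = v * b"
    and ab: "a * b = 1"
  shows "emb (ip (uact act y a - uact act x b) (uact act y a - uact act x b)) =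
    a * a * emb (ip y y) - emb (ip x y) - emb (ip y x) + b * b * emb (ip x x)"
proof -
  have "b * a = 1" using a(2)[of b] ab by simp
  have "a * (v * b) = v" "b * (v * a) = v" for v
    using ab \<open>b * a = 1\<close> a(2)[of v] b(2)[of v] by (metis mult.assoc mult_1_right)+
  moreover have "a * (v * a) = a * a * v" "b * (v * b) = b * b * v" for v
    using a(2)[of v] b(2)[of v] by (simp_all add: mult.assoc)
  ultimately show ?thesis
    by (simp only: ip_diff_left ip_diff_right emb_diff emb_ip_uact_left emb_ip_uact_right
        a(1) b(1) mult.assoc) (simp add: algebra_simps)
qed

end

theorem theorem3p1:
  fixes act :: "'x::complex_vector \<Rightarrow> 'a::cstar_algebra \<Rightarrow> 'x"
    and ip :: "'x \<Rightarrow> 'x \<Rightarrow> 'a"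
    and f :: "real \<Rightarrow> real"
    and c :: 'a and x y :: 'x
  assumes "hilbert_module act ip"
    and "\<forall>t\<ge>0. f t > 0"
    and "\<exists>M>0. \<forall>t\<ge>0. f t \<ge> t + M"
    and "positive_elem (emb c)" and "central c"
    and "continuous_on (real_spectrum (emb c)) f"
  defines "fc \<equiv> cfc f (emb c)"
  defines "lhs \<equiv> (modulus ip (uact act y (cpow (fc - emb c) (-1/2))
                            - uact act x (cpow (fc - emb c) (1/2))))\<^sup>2
                + emb c * (modulus ip x)\<^sup>2"
    and "rhs \<equiv> emb c * cpow fc (-1) * cpow (fc - emb c) (-1) * (modulus ip y)\<^sup>2"
  shows "cstar_le rhs lhs \<and> (lhs = rhs \<longleftrightarrow> y = uact act x fc)"
proof -
  interpret hilbert_module act ip by fact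
  define C where "C = emb c"
  define D where "D = fc - C"
  have sa: "ustar C = C" and nonneg: "real_spectrum C \<subseteq> {0..}"
    using assms(4) by (auto simp: C_def positive_elem_def real_spectrum_def)
  have central: "v * C = C * v" for v
    using assms(5) by (auto intro!: unitization.expand simp: C_def central_def)
  have cont: "continuous_on (real_spectrum C) f" using assms(6) by (simp add: C_def)
  have F: "is_cfc f C fc"
    unfolding fc_def C_def[symmetric] by (rule is_cfc_cfc[OF sa cont])
  have D: "is_cfc (\<lambda>t. f t - t) C D"
    unfolding D_def by (rule is_cfc_diff[OF F is_cfc_ident])
  have "continuous_on (real_spectrum C) (\<lambda>t. f t - t)"
    by (intro continuous_intros cont)
  \<comment> \<open>Here \<open>M\<close> enters: on the spectrum, \<open>t\<close> is nonnegative
    and \<open>f t - t\<close> is at least \<open>M\<close>.\<close>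
  from real_spectrum_cfc[OF sa this D] have D_pos: "real_spectrum D \<subseteq> {0<..}"
    using nonneg assms(3) by fastforce
  have F_pos: "real_spectrum fc \<subseteq> {0<..}"
    using real_spectrum_cfc[OF sa cont F] nonneg assms(2) by fastforce
  note sa_F = is_cfc_self_adjoint[OF sa F] and sa_D = is_cfc_self_adjoint[OF sa D]
  have central_F: "v * fc = fc * v" and central_D: "v * D = D * v" for v
    using is_cfc_commute[OF F central] is_cfc_commute[OF D central] by simp_all
  note cpow_F = is_cfc_cpow[OF sa_F F_pos] and cpow_D = is_cfc_cpow[OF sa_D D_pos]
  note sa_cpow = is_cfc_self_adjoint[OF sa_F cpow_F] is_cfc_self_adjoint[OF sa_D cpow_D]
  have central_cpow: "cpow fc s * v = v * cpow fc s" "cpow D s * v = v * cpow D s" for v s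
    using is_cfc_commute[OF cpow_F central_F] is_cfc_commute[OF cpow_D central_D] by simp_all
  note mult_F = cpow_mult[OF sa_F F_pos] and mult_D = cpow_mult[OF sa_D D_pos]
  note one_F = cpow_one[OF sa_F F_pos] and one_D = cpow_one[OF sa_D D_pos]
  note zero_F = cpow_zero[OF sa_F F_pos] and zero_D = cpow_zero[OF sa_D D_pos]
  define z where "z = uact act y (cpow fc (-1/2)) - uact act x (cpow fc (1/2))"
  have z: "emb (ip z z) =
      cpow fc (-1) * emb (ip y y) - emb (ip x y) - emb (ip y x) + fc * emb (ip x x)"
    unfolding z_def
    using emb_ip_uact_diff[OF sa_cpow(1) central_cpow(1) sa_cpow(1) central_cpow(1),
        of "-1/2" "1/2"]
    by (simp add: mult_F one_F zero_F)
  have lhs: "lhs = cpow D (-1) * emb (ip y y) - emb (ip x y) - emb (ip y x) + D * emb (ip x x)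
      + C * emb (ip x x)"
    unfolding lhs_def modulus_power2 C_def[symmetric] D_def[symmetric]
    using emb_ip_uact_diff[OF sa_cpow(2) central_cpow(2) sa_cpow(2) central_cpow(2),
        of "-1/2" "1/2"]
    by (simp add: mult_D one_D zero_D)
  have rhs: "rhs = C * cpow fc (-1) * cpow D (-1) * emb (ip y y)"
    unfolding rhs_def modulus_power2 C_def[symmetric] D_def[symmetric] ..
  have inv: "cpow fc (-1) * fc = 1" "D * cpow D (-1) = 1"
    using mult_F[of "-1" 1] mult_D[of 1 "-1"] by (simp_all add: one_F one_D zero_F zero_D)
  \<comment> \<open>Partial fractions: taking out \<open>cpow fc (-1)\<close> and
    \<open>cpow D (-1)\<close> leaves \<open>fc - C\<close>, which is \<open>D\<close>.\<close>
  have "cpow D (-1) - C * cpow fc (-1) * cpow D (-1) = cpow fc (-1) * (fc - C) * cpow D (-1)"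
    using inv(1) central[of "cpow fc (-1)"] by (simp add: left_diff_distrib right_diff_distrib)
  also have "\<dots> = cpow fc (-1)"
    using inv(2) by (simp add: D_def[symmetric] mult.assoc)
  finally have split: "cpow D (-1) = cpow fc (-1) + C * cpow fc (-1) * cpow D (-1)"
    by (simp add: algebra_simps)
  have "cpow D (-1) * emb (ip y y) = cpow fc (-1) * emb (ip y y) + rhs"
    unfolding rhs by (subst split) (simp add: distrib_right)
  then have diff: "lhs - rhs = emb (ip z z)"
    unfolding lhs z by (simp add: D_def algebra_simps)
  have sa_ip: "ustar (emb (ip v v)) = emb (ip v v)" for v
    by (simp add: ustar_emb star_ip)
  \<comment> \<open>\<open>cstar_le\<close> asks for self-adjointness of each side, not just of the
    difference; \<open>rhs\<close> is a product of commuting self-adjoint factors.\<close>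
  have sa_rhs: "ustar rhs = rhs"
  proof -
    have "ustar rhs = emb (ip y y) * (cpow D (-1) * (cpow fc (-1) * C))"
      by (simp add: rhs ustar_mult sa_cpow sa sa_ip)
    also have "cpow fc (-1) * C = C * cpow fc (-1)"
      by (rule central)
    also have "cpow D (-1) * (C * cpow fc (-1)) = C * cpow fc (-1) * cpow D (-1)"
      by (rule central_cpow)
    also have "emb (ip y y) * (C * cpow fc (-1) * cpow D (-1)) = rhs"
      unfolding rhs by (metis mult.assoc central central_cpow)
    finally show ?thesis .
  qed
  have "lhs = rhs + emb (ip z z)" using diff by (simp add: algebra_simps)
  then have "ustar lhs = lhs" by (simp add: ustar_add sa_rhs sa_ip)
  then have le: "cstar_le rhs lhs"
    using sa_rhs ip_positive[of z] by (simp add: cstar_le_def diff)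
  have "lhs = rhs \<longleftrightarrow> emb (ip z z) = 0" using diff by (metis right_minus_eq)
  also have "\<dots> \<longleftrightarrow> z = 0"
    using ip_definite[of z] ip_diff_right[of z z z] by (auto simp: emb_def zero_unitization_def)
  also have "\<dots> \<longleftrightarrow> uact act y (cpow fc (-1/2)) = uact act x (cpow fc (1/2))"
    by (simp add: z_def)
  also have "\<dots> \<longleftrightarrow> y = uact act x fc"
  proof
    assume "uact act y (cpow fc (-1/2)) = uact act x (cpow fc (1/2))"
    then have "uact act y (cpow fc (-1/2) * cpow fc (1/2)) = uact act x (cpow fc (1/2) * cpow fc (1/2))"
      by (simp add: uact_mult)
    then show "y = uact act x fc" by (simp add: mult_F zero_F one_F uact_one)
  next
    assume "y = uact act x fc"
    moreover have "fc * cpow fc (-1/2) = cpow fc (1/2)"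
      using mult_F[of 1 "-1/2"] by (simp add: one_F)
    ultimately show "uact act y (cpow fc (-1/2)) = uact act x (cpow fc (1/2))"
      by (simp add: uact_mult[symmetric])
  qed
  finally show ?thesis using le by blast
qed

end
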